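(* Let $s\ge 2$, let $c_1,\dots,c_s\in\mathbb{R}$ be distinct (and otherwise free), let $\lambda>0$ be a solution of $L'_{s+1}\left(\frac{s+1}{\lambda}\right)=0$, and let $\overline{\mathbf{V}}\in\mathbb{R}^{s\times s}$ be the matrix whose first row is $(v_1,\dots,v_s)$ with $$v_i=(-1)^{s+1}\,\frac{s-i+2}{s+1}\,\lambda^{i-1}\,L_{s+1}^{(s-i+2)}\left(\frac{s+1}{\lambda}\right)$$ and whose other rows are zero. Then the coefficients of the parallel IMEX DIMSIM with $p=q=r=s$ (order $p=s$, stage order $q=s$) and with $\mathbf{A}=\mathbf{0}_{s\times s}$, $\widehat{\mathbf{A}}=\lambda\,\mathbf{I}_{s\times s}$, $\mathbf{U}=\mathbf{I}_{s\times s}$, $\mathbf{V}=\mathbf{T}\,\overline{\mathbf{V}}\,\mathbf{T}^{-1}$ are given by $$\mathbf{B}=\mathbf{T}\left(\widehat{\mathbf{E}}_s-\overline{\mathbf{V}}\,\mathbf{K}_s^T\right)\mathbf{T}^{-1},\qquad \widehat{\mathbf{B}}=\mathbf{T}\left(\widehat{\mathbf{E}}_s-\lambda\,\mathbf{E}_s+\overline{\mathbf{V}}\left(\lambda\,\mathbf{I}_{s\times s}-\mathbf{K}_s^T\right)\right)\mathbf{T}^{-1}.$$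
   Context: Setting: the autonomous ODE $y'=f(y)+g(y)$, $y(t)\in\mathbb{R}^d$, with $f,g$ sufficiently smooth. An IMEX general linear method (IMEX GLM) with $s$ internal stages $Y_i$, $r$ external stages $y^{[n]}_i$, timestep $h$, abscissae $\mathbf{c}=(c_1,\dots,c_s)^T$ and coefficient matrices $\mathbf{A}=(a_{i,j})$ (strictly lower triangular) and $\widehat{\mathbf{A}}=(\widehat a_{i,j})$ (lower triangular) in $\mathbb{R}^{s\times s}$, $\mathbf{B}=(b_{i,j}),\widehat{\mathbf{B}}=(\widehat b_{i,j})\in\mathbb{R}^{r\times s}$, $\mathbf{U}=(u_{i,j})\in\mathbb{R}^{s\times r}$, $\mathbf{V}=(v_{i,j})\in\mathbb{R}^{r\times r}$ is $$Y_i=h\sum_{j=1}^{i-1}a_{i,j}f(Y_j)+h\sum_{j=1}^{i}\widehat a_{i,j}g(Y_j)+\sum_{j=1}^r u_{i,j}y^{[n-1]}_j,\quad i=1,\dots,s,$$ $$y^{[n]}_i=h\sum_{j=1}^s\left(b_{i,j}f(Y_j)+\widehat b_{i,j}g(Y_j)\right)+\sum_{j=1}^r v_{i,j}y^{[n-1]}_j,\quad i=1,\dots,r.$$ An IMEX DIMSIM is such a method where $\widehat{\mathbf{A}}$ has constant diagonal $\lambda$, $\mathbf{V}$ is rank one with its single nonzero eigenvalue equal to $1$, $q\in\{p,p-1\}$ and $r\in\{s,s+1\}$; it is parallel if $\mathbf{A}=\mathbf{0}$ and $\widehat{\mathbf{A}}=\lambda\mathbf{I}$. Order. There are external stage weights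 $\mathbf{W}=(w_{i,k}),\widehat{\mathbf{W}}=(\widehat w_{i,k})\in\mathbb{R}^{r\times(p+1)}$, $k=0,\dots,p$, with $w_{i,0}=\widehat w_{i,0}$. Assume the incoming external stages satisfy $$y^{[n-1]}_i=w_{i,0}\,y(t_{n-1})+\sum_{k=1}^p w_{i,k}h^k\frac{d^{k-1}f(y(t))}{dt^{k-1}}(t_{n-1})+\sum_{k=1}^p\widehat w_{i,k}h^k\frac{d^{k-1}g(y(t))}{dt^{k-1}}(t_{n-1})+O(h^{p+1}).$$ The method has stage order $q$ if $Y_i=y(t_{n-1}+c_ih)+O(h^{q+1})$ for all $i$, and order $p$ if $y^{[n]}_i$ satisfies the same expansion with $t_{n-1}$ replaced by $t_n=t_{n-1}+h$. Known characterization (Zhang, Sandu, Blaise), which may be used: with $\mathbf{C}_n=\left[\mathbf{1}_s\ \ \mathbf{c}\ \ \tfrac{\mathbf{c}^2}{2}\ \cdots\ \tfrac{\mathbf{c}^{n-1}}{(n-1)!}\right]\in\mathbb{R}^{s\times n}$ (component-wise powers), the IMEX GLM has order $p$ and stage order $q\in\{p,p-1\}$ iff $$\mathbf{C}_{q+1}-\mathbf{A}\mathbf{C}_{q+1}\mathbf{K}_{q+1}-\mathbf{U}\mathbf{W}_{:,0:q}=\mathbf{0},\qquad \mathbf{C}_{q+1}-\widehat{\mathbf{A}}\mathbf{C}_{q+1}\mathbf{K}_{q+1}-\mathbf{U}\widehat{\mathbf{W}}_{:,0:q}=\mathbf{0},$$ $$\mathbf{W}\mathbf{E}_{p+1}-\mathbf{B}\mathbf{C}_{p+1}\mathbf{K}_{p+1}-\mathbf{V}\mathbf{W}=\mathbf{0},\qquad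 \widehat{\mathbf{W}}\mathbf{E}_{p+1}-\widehat{\mathbf{B}}\mathbf{C}_{p+1}\mathbf{K}_{p+1}-\mathbf{V}\widehat{\mathbf{W}}=\mathbf{0},$$ where $\mathbf{W}_{:,0:q}$ denotes the first $q+1$ columns. Notation. $\mathbf{K}_n\in\mathbb{R}^{n\times n}$ has ones on the first superdiagonal and zeros elsewhere; $\mathbf{E}_n=\exp(\mathbf{K}_n)$. $\widehat{\mathbf{E}}_n\in\mathbb{R}^{n\times n}$ is the upper Hessenberg Toeplitz matrix with entries $\frac{1}{(j-i+1)!}$ for $j\ge i-1$ and $0$ for $j<i-1$. With $P(x)=\frac{1}{s!}\prod_{i=1}^s(x-c_i)$, $\mathbf{T}\in\mathbb{R}^{s\times s}$ has entries $\mathbf{T}_{i,j}=P^{(s-j+1)}(c_i)$ (so the row $i$ is $P^{(s)}(c_i),P^{(s-1)}(c_i),\dots,P'(c_i)$). $L_n(x)=\sum_{i=0}^n\binom{n}{i}\frac{(-x)^i}{i!}$ is the Laguerre polynomial and $L_n^{(m)}$ its $m$-th derivative. *)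

theory Defs
  imports
    "HOL-Analysis.Analysis"
    "HOL-Library.Landau_Symbols"
    "HOL-Computational_Algebra.Polynomial"
    "Jordan_Normal_Form.Matrix"
    "Jordan_Normal_Form.Gauss_Jordan_Elimination"
    "Jordan_Normal_Form.Char_Poly"
    "Jordan_Normal_Form.DL_Rank"
begin

(* All matrices, and the families of stages and abscissae, are indexed from 0. *)

section \<open>Smooth vector fields and derivatives along a trajectory\<close>

(* In finite dimension this is the usual class C^n, with the n-th derivative
   evaluated one direction at a time to avoid a change of type in the recursion. *)
primrec ntimes_cont_diff :: "nat \<Rightarrow> ('a::euclidean_space \<Rightarrow> 'b::real_normed_vector) \<Rightarrow> bool" where
  "ntimes_cont_diff 0 f \<longleftrightarrow> continuous_on UNIV f"
| "ntimes_cont_diff (Suc n) f \<longleftrightarrow>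
     (\<forall>x. f differentiable (at x)) \<and>
     (\<forall>v. ntimes_cont_diff n (\<lambda>x. frechet_derivative f (at x) v))"

definition smooth_field :: "('a::euclidean_space \<Rightarrow> 'a) \<Rightarrow> bool" where
  "smooth_field f \<longleftrightarrow> (\<forall>n. ntimes_cont_diff n f)"

definition nth_vderiv :: "nat \<Rightarrow> (real \<Rightarrow> 'a::real_normed_vector) \<Rightarrow> real \<Rightarrow> 'a" where
  "nth_vderiv k F = ((\<lambda>G t. vector_derivative G (at t)) ^^ k) F"

definition ode_solution_near ::
    "('a::euclidean_space \<Rightarrow> 'a) \<Rightarrow> ('a \<Rightarrow> 'a) \<Rightarrow> (real \<Rightarrow> 'a) \<Rightarrow> real \<Rightarrow> bool" where
  "ode_solution_near f g y t0 \<longleftrightarrow>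
     (\<forall>\<^sub>F t in nhds t0. (y has_vector_derivative (f (y t) + g (y t))) (at t))"


section \<open>IMEX general linear methods\<close>

record imex_glm =
  ninternal :: nat
  nexternal :: nat
  absc :: "nat \<Rightarrow> real"
  matA :: "real mat"
  matAh :: "real mat"
  matB :: "real mat"
  matBh :: "real mat"
  matU :: "real mat"
  matV :: "real mat"

definition imex_glm_wf :: "imex_glm \<Rightarrow> bool" where
  "imex_glm_wf M \<longleftrightarrow>
     matA M \<in> carrier_mat (ninternal M) (ninternal M) \<and>
     matAh M \<in> carrier_mat (ninternal M) (ninternal M) \<and>
     matB M \<in> carrier_mat (nexternal M) (ninternal M) \<and>
     matBh M \<in> carrier_mat (nexternal M) (ninternal M) \<and>
     matU M \<in> carrier_mat (ninternal M) (nexternal M) \<and>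
     matV M \<in> carrier_mat (nexternal M) (nexternal M) \<and>
     (\<forall>i<ninternal M. \<forall>j<ninternal M. i \<le> j \<longrightarrow> matA M $$ (i, j) = 0) \<and>
     (\<forall>i<ninternal M. \<forall>j<ninternal M. i < j \<longrightarrow> matAh M $$ (i, j) = 0)"

definition internal_stages ::
    "imex_glm \<Rightarrow> ('a::euclidean_space \<Rightarrow> 'a) \<Rightarrow> ('a \<Rightarrow> 'a) \<Rightarrow> real
      \<Rightarrow> (nat \<Rightarrow> 'a) \<Rightarrow> (nat \<Rightarrow> 'a) \<Rightarrow> bool" where
  "internal_stages M f g h yin Y \<longleftrightarrow>
     (\<forall>i<ninternal M. Y i =
        h *\<^sub>R (\<Sum>j<i. matA M $$ (i, j) *\<^sub>R f (Y j))
      + h *\<^sub>R (\<Sum>j\<le>i. matAh M $$ (i, j) *\<^sub>R g (Y j))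
      + (\<Sum>j<nexternal M. matU M $$ (i, j) *\<^sub>R yin j))"

definition external_stages ::
    "imex_glm \<Rightarrow> ('a::euclidean_space \<Rightarrow> 'a) \<Rightarrow> ('a \<Rightarrow> 'a) \<Rightarrow> real
      \<Rightarrow> (nat \<Rightarrow> 'a) \<Rightarrow> (nat \<Rightarrow> 'a) \<Rightarrow> (nat \<Rightarrow> 'a) \<Rightarrow> bool" where
  "external_stages M f g h yin Y yout \<longleftrightarrow>
     (\<forall>i<nexternal M. yout i =
        h *\<^sub>R (\<Sum>j<ninternal M. matB M $$ (i, j) *\<^sub>R f (Y j) + matBh M $$ (i, j) *\<^sub>R g (Y j))
      + (\<Sum>j<nexternal M. matV M $$ (i, j) *\<^sub>R yin j))"


section \<open>Order and stage order\<close>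

definition weight_expansion ::
    "nat \<Rightarrow> real mat \<Rightarrow> real mat \<Rightarrow> ('a::euclidean_space \<Rightarrow> 'a) \<Rightarrow> ('a \<Rightarrow> 'a) \<Rightarrow> (real \<Rightarrow> 'a)
      \<Rightarrow> real \<Rightarrow> real \<Rightarrow> nat \<Rightarrow> 'a" where
  "weight_expansion p W Wh f g y h t i =
     W $$ (i, 0) *\<^sub>R y t
     + (\<Sum>k=1..p. (W $$ (i, k) * h ^ k) *\<^sub>R nth_vderiv (k - 1) (\<lambda>\<tau>. f (y \<tau>)) t)
     + (\<Sum>k=1..p. (Wh $$ (i, k) * h ^ k) *\<^sub>R nth_vderiv (k - 1) (\<lambda>\<tau>. g (y \<tau>)) t)"

(* One step from t0 for all small h > 0.  As h tends to 0 the families of stages depend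
   on h.  Since the stage equations are implicit and f, g need not be globally Lipschitz,
   they may have spurious solutions that blow up as h tends to 0 (e.g. of size 1/h for a
   quadratic g); boundedness of the internal stages excludes exactly these. *)
definition imex_step ::
    "imex_glm \<Rightarrow> nat \<Rightarrow> real mat \<Rightarrow> real mat
      \<Rightarrow> ('a::euclidean_space \<Rightarrow> 'a) \<Rightarrow> ('a \<Rightarrow> 'a) \<Rightarrow> (real \<Rightarrow> 'a) \<Rightarrow> real
      \<Rightarrow> (real \<Rightarrow> nat \<Rightarrow> 'a) \<Rightarrow> (real \<Rightarrow> nat \<Rightarrow> 'a) \<Rightarrow> (real \<Rightarrow> nat \<Rightarrow> 'a) \<Rightarrow> bool" where
  "imex_step M p W Wh f g y t0 yin Y yout \<longleftrightarrow>
     smooth_field f \<and> smooth_field g \<and> ode_solution_near f g y t0 \<and>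
     (\<forall>i<nexternal M. (\<lambda>h. norm (yin h i - weight_expansion p W Wh f g y h t0 i))
        \<in> O[at_right 0](\<lambda>h. h ^ (p + 1))) \<and>
     (\<forall>i<ninternal M. Bfun (\<lambda>h. Y h i) (at_right 0)) \<and>
     (\<forall>\<^sub>F h in at_right 0. internal_stages M f g h (yin h) (Y h)) \<and>
     (\<forall>\<^sub>F h in at_right 0. external_stages M f g h (yin h) (Y h) (yout h))"

(* The argument of type 'a itself fixes the phase space of the differential equation. *)
definition has_stage_order ::
    "'a::euclidean_space itself \<Rightarrow> imex_glm \<Rightarrow> nat \<Rightarrow> real mat \<Rightarrow> real mat \<Rightarrow> nat \<Rightarrow> bool" where
  "has_stage_order _ M p W Wh q \<longleftrightarrow>
     (\<forall>(f :: 'a \<Rightarrow> 'a) g y t0 yin Y yout.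
        imex_step M p W Wh f g y t0 yin Y yout \<longrightarrow>
        (\<forall>i<ninternal M. (\<lambda>h. norm (Y h i - y (t0 + absc M i * h)))
           \<in> O[at_right 0](\<lambda>h. h ^ (q + 1))))"

definition has_order ::
    "'a::euclidean_space itself \<Rightarrow> imex_glm \<Rightarrow> nat \<Rightarrow> real mat \<Rightarrow> real mat \<Rightarrow> bool" where
  "has_order _ M p W Wh \<longleftrightarrow>
     (\<forall>(f :: 'a \<Rightarrow> 'a) g y t0 yin Y yout.
        imex_step M p W Wh f g y t0 yin Y yout \<longrightarrow>
        (\<forall>i<nexternal M. (\<lambda>h. norm (yout h i - weight_expansion p W Wh f g y h (t0 + h) i))
           \<in> O[at_right 0](\<lambda>h. h ^ (p + 1))))"

definition order_and_stage_order ::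
    "'a::euclidean_space itself \<Rightarrow> imex_glm \<Rightarrow> nat \<Rightarrow> nat \<Rightarrow> bool" where
  "order_and_stage_order ty M p q \<longleftrightarrow>
     (\<exists>W Wh. W \<in> carrier_mat (nexternal M) (p + 1) \<and> Wh \<in> carrier_mat (nexternal M) (p + 1) \<and>
        (\<forall>i<nexternal M. W $$ (i, 0) = Wh $$ (i, 0)) \<and>
        has_stage_order ty M p W Wh q \<and> has_order ty M p W Wh)"


section \<open>IMEX DIMSIMs\<close>

definition imex_dimsim ::
    "'a::euclidean_space itself \<Rightarrow> imex_glm \<Rightarrow> real \<Rightarrow> nat \<Rightarrow> nat \<Rightarrow> bool" where
  "imex_dimsim ty M lam p q \<longleftrightarrow>
     imex_glm_wf M \<and>
     (\<forall>i<ninternal M. matAh M $$ (i, i) = lam) \<and>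
     vec_space.rank (nexternal M) (matV M) = 1 \<and>
     {z. eigenvalue (map_mat complex_of_real (matV M)) z \<and> z \<noteq> 0} = {1} \<and>
     (q = p \<or> q + 1 = p) \<and>
     (nexternal M = ninternal M \<or> nexternal M = ninternal M + 1) \<and>
     order_and_stage_order ty M p q"

definition parallel_imex_dimsim ::
    "'a::euclidean_space itself \<Rightarrow> imex_glm \<Rightarrow> real \<Rightarrow> nat \<Rightarrow> nat \<Rightarrow> bool" where
  "parallel_imex_dimsim ty M lam p q \<longleftrightarrow>
     imex_dimsim ty M lam p q \<and>
     matA M = 0\<^sub>m (ninternal M) (ninternal M) \<and>
     matAh M = lam \<cdot>\<^sub>m 1\<^sub>m (ninternal M)"


section \<open>Matrices and polynomials in the coefficient formulas\<close>

(* Entrywise power series; meaningful for square matrices. *)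
definition mat_exp :: "real mat \<Rightarrow> real mat" where
  "mat_exp A = mat (dim_row A) (dim_col A) (\<lambda>(i, j). \<Sum>n. (A ^\<^sub>m n) $$ (i, j) / fact n)"

(* The two-sided inverse whenever A is an invertible square matrix, unspecified otherwise. *)
definition mat_inv :: "real mat \<Rightarrow> real mat" where
  "mat_inv A = the (mat_inverse A)"

definition K_mat :: "nat \<Rightarrow> real mat" where
  "K_mat n = mat n n (\<lambda>(i, j). if j = i + 1 then 1 else 0)"

definition E_mat :: "nat \<Rightarrow> real mat" where
  "E_mat n = mat_exp (K_mat n)"

definition Eh_mat :: "nat \<Rightarrow> real mat" where
  "Eh_mat n = mat n n (\<lambda>(i, j). if i \<le> j + 1 then 1 / fact (j + 1 - i) else 0)"

definition P_poly :: "nat \<Rightarrow> (nat \<Rightarrow> real) \<Rightarrow> real poly" where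
  "P_poly s c = Polynomial.smult (1 / fact s) (\<Prod>i<s. [:- c i, 1:])"

definition T_mat :: "nat \<Rightarrow> (nat \<Rightarrow> real) \<Rightarrow> real mat" where
  "T_mat s c = mat s s (\<lambda>(i, j). poly ((pderiv ^^ (s - j)) (P_poly s c)) (c i))"

definition laguerre_poly :: "nat \<Rightarrow> real poly" where
  "laguerre_poly n = (\<Sum>i\<le>n. monom (real (n choose i) * (- 1) ^ i / fact i) i)"

(* v_coeff is indexed from 1 to s. *)
definition v_coeff :: "nat \<Rightarrow> real \<Rightarrow> nat \<Rightarrow> real" where
  "v_coeff s lam i =
     (- 1) ^ (s + 1) * (real (s + 2 - i) / real (s + 1)) * lam ^ (i - 1)
     * poly ((pderiv ^^ (s + 2 - i)) (laguerre_poly (s + 1))) (real (s + 1) / lam)"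

definition Vbar_mat :: "nat \<Rightarrow> real \<Rightarrow> real mat" where
  "Vbar_mat s lam = mat s s (\<lambda>(i, j). if i = 0 then v_coeff s lam (j + 1) else 0)"

end

theory Submission
  imports Defs
begin

text \<open>Along a smooth trajectory every stage has a Taylor expansion in powers of \<open>h\<close> whose
  coefficients are the derivatives of \<open>f (y t)\<close> and \<open>g (y t)\<close>.  Since the implicit term
  \<open>h \<lambda> g(Y)\<close> is a contraction for small \<open>h\<close> on bounded sets, the stages have order \<open>p\<close> as soon as
  the expansion of the stage defect vanishes, and the linear problems \<open>y' = y\<close>, with the right-hand
  side assigned to \<open>f\<close> or to \<open>g\<close>, show that this is also necessary.  This forces
  \<open>W = [c\<^sup>k / k!]\<close> and \<open>Wh = [c\<^sup>k / k! - \<lambda> c\<^sup>k\<^sup>-\<^sup>1 / (k - 1)!]\<close>, so the order conditions say that for each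
  polynomial \<open>\<phi>\<close> of degree at most \<open>s\<close>, at the nodes,
  \<open>B \<phi>'(c) = \<phi>(c + 1) - V \<phi>(c)\<close> and \<open>Bh \<phi>'(c) = \<psi>(c + 1) - V \<psi>(c)\<close> with \<open>\<psi> = \<phi> - \<lambda> \<phi>'\<close>.
  Inserting for \<open>\<phi>\<close> the derivatives of \<open>P\<close>, whose values are the columns of \<open>T\<close>, gives the
  formulas; \<open>\<phi> = 1\<close> gives the condition \<open>V 1 = 1\<close>, which holds because \<open>v\<^sub>1 = 1\<close>.\<close>

section \<open>Smooth fields\<close>

text \<open>Three obstacles shape the equivalence. Order and stage order quantify over all steps, so
  necessity needs problems for which a step really exists; for linear ones the implicit stages can
  be solved explicitly. The weights are only asserted to exist, but with \<open>U = I\<close> and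
  stage order equal to the order, each of their \<open>p + 1\<close> columns is forced, so they can
  be eliminated. Finally, a row of \<open>B\<close> has s unknowns but meets s + 1 conditions: the
  one for constants does not contain \<open>B\<close> and becomes the consistency condition on
  \<open>V\<close>, and the other s determine the row because \<open>T\<close> is invertible for
  distinct nodes. The derivatives of \<open>P\<close> serve better than monomials for two reasons.
  Each is the derivative of the next, so the unit shift acts on them with Toeplitz coefficients
  1/m!, which are the entries of \<open>E_mat\<close> and, one index further, of
  \<open>Eh_mat\<close>. And \<open>P\<close> itself vanishes at all nodes, so a family of s + 1
  polynomials closes up into matrices of size s.\<close>

lemma ntimes_cont_diff_const: "ntimes_cont_diff n (\<lambda>x. c)"
  by (induction n arbitrary: c) (auto simp: frechet_derivative_const)

lemma ntimes_cont_diff_linear: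
  fixes L :: "'a::euclidean_space \<Rightarrow> 'b::real_normed_vector"
  assumes "bounded_linear L"
  shows "ntimes_cont_diff n L"
proof (cases n)
  case 0
  then show ?thesis
    using assms by (simp add: linear_continuous_on)
next
  case (Suc k)
  have "frechet_derivative L (at x) = L" for x
    using bounded_linear_imp_has_derivative[OF assms] by (rule frechet_derivative_at[symmetric])
  then show ?thesis
    using Suc assms by (simp add: ntimes_cont_diff_const bounded_linear_imp_differentiable)
qed

lemma ntimes_cont_diff_add:
  assumes "ntimes_cont_diff n u" "ntimes_cont_diff n v"
  shows "ntimes_cont_diff n (\<lambda>x. u x + v x)"
  using assms
proof (induction n arbitrary: u v)
  case 0
  then show ?case by (simp add: continuous_on_add)
next
  case (Suc n)
  have D: "((\<lambda>x. u x + v x) has_derivative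
      (\<lambda>w. frechet_derivative u (at x) w + frechet_derivative v (at x) w)) (at x)" for x
    using Suc.prems by (intro has_derivative_add) (auto simp: frechet_derivative_works[symmetric])
  have "frechet_derivative (\<lambda>x. u x + v x) (at x)
      = (\<lambda>w. frechet_derivative u (at x) w + frechet_derivative v (at x) w)" for x
    using D by (rule frechet_derivative_at[symmetric])
  then show ?case
    using Suc differentiableI[OF D] by simp
qed

lemma ntimes_cont_diff_sum:
  assumes "\<And>i. i \<in> I \<Longrightarrow> ntimes_cont_diff n (u i)"
  shows "ntimes_cont_diff n (\<lambda>x. \<Sum>i\<in>I. u i x)"
  using assms
  by (induction I rule: infinite_finite_induct)
     (auto simp: ntimes_cont_diff_const ntimes_cont_diff_add)

lemma ntimes_cont_diff_bounded_linear:
  assumes L: "bounded_linear L" and "ntimes_cont_diff n u"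
  shows "ntimes_cont_diff n (\<lambda>x. L (u x))"
  using assms(2)
proof (induction n arbitrary: u)
  case 0
  then show ?case
    by (simp add: bounded_linear.continuous_on[OF L])
next
  case (Suc n)
  have D: "((\<lambda>x. L (u x)) has_derivative (\<lambda>w. L (frechet_derivative u (at x) w))) (at x)" for x
    by (rule bounded_linear.has_derivative[OF L])
       (use Suc.prems in \<open>simp add: frechet_derivative_works[symmetric]\<close>)
  have "frechet_derivative (\<lambda>x. L (u x)) (at x) = (\<lambda>w. L (frechet_derivative u (at x) w))" for x
    using D by (rule frechet_derivative_at[symmetric])
  then show ?case
    using Suc differentiableI[OF D] by simp
qed

text \<open>The product rule asks for \<open>u\<close> and \<open>v\<close> themselves at the lower
  level as well as their derivatives. Assuming every level at once supplies this without showing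
  that the classes are nested.\<close>

lemma ntimes_cont_diff_scaleR:
  assumes "\<And>n. ntimes_cont_diff n u" "\<And>n. ntimes_cont_diff n v"
  shows "ntimes_cont_diff n (\<lambda>x. u x *\<^sub>R v x)"
  using assms
proof (induction n arbitrary: u v)
  case 0
  have "continuous_on UNIV u" "continuous_on UNIV v"
    using 0(1)[of 0] 0(2)[of 0] by simp_all
  then show ?case
    by (simp add: continuous_on_scaleR)
next
  case (Suc n)
  have du: "(u has_derivative frechet_derivative u (at x)) (at x)"
    and dv: "(v has_derivative frechet_derivative v (at x)) (at x)" for x
    using Suc(2)[of 1] Suc(3)[of 1] by (auto simp: frechet_derivative_works[symmetric])
  have D: "((\<lambda>x. u x *\<^sub>R v x) has_derivative
      (\<lambda>w. u x *\<^sub>R frechet_derivative v (at x) w + frechet_derivative u (at x) w *\<^sub>R v x)) (at x)" for x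
    by (rule has_derivative_scaleR[OF du dv])
  have E: "frechet_derivative (\<lambda>x. u x *\<^sub>R v x) (at x)
      = (\<lambda>w. u x *\<^sub>R frechet_derivative v (at x) w + frechet_derivative u (at x) w *\<^sub>R v x)" for x
    using D by (rule frechet_derivative_at[symmetric])
  have u': "ntimes_cont_diff m (\<lambda>x. frechet_derivative u (at x) w)"
    and v': "ntimes_cont_diff m (\<lambda>x. frechet_derivative v (at x) w)" for m w
    using Suc(2)[of "Suc m"] Suc(3)[of "Suc m"] by auto
  have S: "ntimes_cont_diff n (\<lambda>x. u x *\<^sub>R frechet_derivative v (at x) w
      + frechet_derivative u (at x) w *\<^sub>R v x)" for w
    by (intro ntimes_cont_diff_add Suc.IH Suc.prems u' v')
  then show ?case
    by (simp add: E S differentiableI[OF D])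
qed

text \<open>The Lie derivative of \<open>\<phi>\<close> along the vector field
  \<open>F\<close>.\<close>

definition traj_deriv ::
    "('a::euclidean_space \<Rightarrow> 'a) \<Rightarrow> ('a \<Rightarrow> 'b::real_normed_vector) \<Rightarrow> 'a \<Rightarrow> 'b" where
  "traj_deriv F \<phi> x = frechet_derivative \<phi> (at x) (F x)"

lemma smooth_imp_has_derivative:
  assumes "\<And>n. ntimes_cont_diff n \<phi>"
  shows "(\<phi> has_derivative frechet_derivative \<phi> (at x)) (at x)"
  using assms[of 1] by (simp add: frechet_derivative_works[symmetric])

text \<open>\<open>ntimes_cont_diff\<close> speaks of derivatives in a fixed direction, whereas here
  the direction \<open>F x\<close> moves with the point. Expanding \<open>F x\<close> in the basis
  leaves fixed directions with smooth scalar factors.\<close>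

lemma smooth_traj_deriv:
  assumes F: "\<And>n. ntimes_cont_diff n F" and phi: "\<And>n. ntimes_cont_diff n \<phi>"
  shows "ntimes_cont_diff n (traj_deriv F \<phi>)"
proof -
  have "traj_deriv F \<phi> x = (\<Sum>b\<in>Basis. inner (F x) b *\<^sub>R frechet_derivative \<phi> (at x) b)" for x
  proof -
    interpret D: bounded_linear "frechet_derivative \<phi> (at x)"
      using smooth_imp_has_derivative[OF phi] by (rule has_derivative_bounded_linear)
    have "traj_deriv F \<phi> x = frechet_derivative \<phi> (at x) (\<Sum>b\<in>Basis. inner (F x) b *\<^sub>R b)"
      by (simp add: traj_deriv_def euclidean_representation)
    then show ?thesis
      by (simp add: D.sum D.scaleR)
  qed
  moreover have "ntimes_cont_diff n (\<lambda>x. frechet_derivative \<phi> (at x) b)" for n b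
    using phi[of "Suc n"] by simp
  moreover have "ntimes_cont_diff n (\<lambda>x. inner (F x) b)" for n b
    by (rule ntimes_cont_diff_bounded_linear[OF bounded_linear_inner_left F])
  ultimately have "ntimes_cont_diff n (\<lambda>x. \<Sum>b\<in>Basis. inner (F x) b *\<^sub>R frechet_derivative \<phi> (at x) b)"
    by (intro ntimes_cont_diff_sum ntimes_cont_diff_scaleR)
  moreover from \<open>\<And>x. traj_deriv F \<phi> x = _\<close>
  have "traj_deriv F \<phi> = (\<lambda>x. \<Sum>b\<in>Basis. inner (F x) b *\<^sub>R frechet_derivative \<phi> (at x) b)"
    by (rule ext)
  ultimately show ?thesis
    by (simp only:)
qed

text \<open>Each directional derivative is continuous, hence bounded on the compact ball. Summing
  the bounds over the basis controls the operator norm, and the mean value inequality applies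
  because the ball is convex.\<close>

lemma smooth_field_Lipschitz_on_cball:
  fixes g :: "'a::euclidean_space \<Rightarrow> 'a"
  assumes "smooth_field g"
  obtains L where "L \<ge> 0"
    and "\<And>x y. norm x \<le> r \<Longrightarrow> norm y \<le> r \<Longrightarrow> norm (g x - g y) \<le> L * norm (x - y)"
proof -
  have g: "\<And>n. ntimes_cont_diff n g"
    using assms by (simp add: smooth_field_def)
  let ?D = "\<lambda>x. frechet_derivative g (at x)"
  have D: "(g has_derivative ?D x) (at x)" for x
    by (rule smooth_imp_has_derivative[OF g])
  have "\<exists>M. \<forall>x\<in>cball 0 r. norm (?D x b) \<le> M" for b
  proof -
    have "continuous_on UNIV (\<lambda>x. ?D x b)"
      using g[of "Suc 0"] by simp
    then have "compact ((\<lambda>x. ?D x b) ` cball 0 r)"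
      by (intro compact_continuous_image) (auto intro: continuous_on_subset)
    then have "bounded ((\<lambda>x. ?D x b) ` cball 0 r)"
      by (rule compact_imp_bounded)
    then show ?thesis
      by (auto simp: bounded_iff)
  qed
  then obtain M where M: "\<And>b x. x \<in> cball 0 r \<Longrightarrow> norm (?D x b) \<le> M b"
    by metis
  define L where "L = (\<Sum>b\<in>Basis. \<bar>M b\<bar>)"
  have on: "onorm (?D x) \<le> L" if x: "x \<in> cball 0 r" for x
  proof (rule onorm_bound)
    fix v :: 'a
    interpret D: bounded_linear "?D x"
      using D by (rule has_derivative_bounded_linear)
    have "norm (?D x v) = norm (\<Sum>b\<in>Basis. inner v b *\<^sub>R ?D x b)"
      using euclidean_representation[of v] by (metis (no_types, lifting) D.scaleR D.sum sum.cong)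
    also have "\<dots> \<le> (\<Sum>b\<in>Basis. \<bar>M b\<bar> * norm v)"
    proof (rule sum_norm_le)
      fix b :: 'a assume b: "b \<in> Basis"
      have "\<bar>inner v b\<bar> * norm (?D x b) \<le> norm v * \<bar>M b\<bar>"
        using Basis_le_norm[OF b, of v] M[OF x, of b] by (intro mult_mono) auto
      then show "norm (inner v b *\<^sub>R ?D x b) \<le> \<bar>M b\<bar> * norm v"
        by (simp add: mult.commute)
    qed
    finally show "norm (?D x v) \<le> L * norm v"
      by (simp add: L_def sum_distrib_right)
  qed (simp add: L_def sum_nonneg)
  show ?thesis
  proof (rule that)
    show "L \<ge> 0" by (simp add: L_def sum_nonneg)
    show "norm (g x - g y) \<le> L * norm (x - y)" if "norm x \<le> r" "norm y \<le> r" for x y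
      using that D on
      by (intro differentiable_bound[of "cball 0 r" g ?D]) (auto intro: has_derivative_at_withinI)
  qed
qed

section \<open>Derivatives along a solution\<close>

lemma traj_has_vector_derivative:
  assumes "\<And>n. ntimes_cont_diff n \<phi>" and "(y has_vector_derivative F (y t)) (at t)"
  shows "((\<lambda>\<tau>. \<phi> (y \<tau>)) has_vector_derivative traj_deriv F \<phi> (y t)) (at t)"
  using vector_derivative_diff_chain_within[OF assms(2)
      has_derivative_at_withinI[OF smooth_imp_has_derivative[OF assms(1)]]]
  by (simp add: traj_deriv_def o_def)

lemma smooth_traj_deriv_funpow:
  assumes "\<And>n. ntimes_cont_diff n F" "\<And>n. ntimes_cont_diff n \<phi>"
  shows "ntimes_cont_diff n ((traj_deriv F ^^ k) \<phi>)"
  by (induction k arbitrary: n) (auto intro: assms smooth_traj_deriv)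

text \<open>Iterated \<open>vector_derivative\<close> is a total operation and says little by
  itself. On an open set where the differential equation holds, each iterate is a smooth function of
  the state, so the next differentiation is legitimate.\<close>

lemma nth_vderiv_along_solution:
  assumes "\<And>n. ntimes_cont_diff n F" "\<And>n. ntimes_cont_diff n \<phi>"
    and S: "open S" "\<And>t. t \<in> S \<Longrightarrow> (y has_vector_derivative F (y t)) (at t)"
  shows "t \<in> S \<Longrightarrow> nth_vderiv k (\<lambda>\<tau>. \<phi> (y \<tau>)) t = (traj_deriv F ^^ k) \<phi> (y t)"
proof (induction k arbitrary: t)
  case 0
  then show ?case by (simp add: nth_vderiv_def)
next
  case (Suc k)
  have "((\<lambda>\<tau>. (traj_deriv F ^^ k) \<phi> (y \<tau>)) has_vector_derivative
      (traj_deriv F ^^ Suc k) \<phi> (y t)) (at t)"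
    using traj_has_vector_derivative[of "(traj_deriv F ^^ k) \<phi>" y F t]
      smooth_traj_deriv_funpow[of F \<phi>] assms Suc.prems by simp
  then have "(nth_vderiv k (\<lambda>\<tau>. \<phi> (y \<tau>)) has_vector_derivative
      (traj_deriv F ^^ Suc k) \<phi> (y t)) (at t)"
    by (rule has_vector_derivative_transform_within_open[OF _ S(1) Suc.prems])
       (use Suc.IH in simp)
  then show ?case
    by (simp add: nth_vderiv_def vector_derivative_at)
qed

lemma nth_vderiv_has_vector_derivative:
  assumes "\<And>n. ntimes_cont_diff n F" "\<And>n. ntimes_cont_diff n \<phi>"
    and S: "open S" "\<And>t. t \<in> S \<Longrightarrow> (y has_vector_derivative F (y t)) (at t)"
    and t: "t \<in> S"
  shows "(nth_vderiv k (\<lambda>\<tau>. \<phi> (y \<tau>)) has_vector_derivative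
    nth_vderiv (Suc k) (\<lambda>\<tau>. \<phi> (y \<tau>)) t) (at t)"
proof -
  have "((\<lambda>\<tau>. (traj_deriv F ^^ k) \<phi> (y \<tau>)) has_vector_derivative
      (traj_deriv F ^^ Suc k) \<phi> (y t)) (at t)"
    using traj_has_vector_derivative[of "(traj_deriv F ^^ k) \<phi>" y F t]
      smooth_traj_deriv_funpow[of F \<phi>] assms by simp
  then have "(nth_vderiv k (\<lambda>\<tau>. \<phi> (y \<tau>)) has_vector_derivative
      (traj_deriv F ^^ Suc k) \<phi> (y t)) (at t)"
    by (rule has_vector_derivative_transform_within_open[OF _ S(1) t])
       (use nth_vderiv_along_solution[OF assms(1-4)] in simp)
  then show ?thesis
    using nth_vderiv_along_solution[OF assms(1-4) t] by simp
qed

text \<open>For vector values there is no mean value equality, so the Lagrange form is replaced by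
  induction: the derivative of the remainder of \<open>D\<close> is the next shorter remainder of
  the shifted sequence, and the mean value inequality on the ball of radius
  \<open>\<bar>x\<bar>\<close> gains one power. The base case is local boundedness.\<close>

lemma Taylor_remainder_bound:
  fixes D :: "nat \<Rightarrow> real \<Rightarrow> 'a::real_normed_vector"
  assumes "\<delta> > 0"
    and "\<And>k t. \<bar>t - t0\<bar> < \<delta> \<Longrightarrow> (D k has_vector_derivative D (Suc k) t) (at t)"
  shows "\<exists>C. \<exists>\<eta>>0. \<forall>x. \<bar>x\<bar> \<le> \<eta> \<longrightarrow>
    norm (D 0 (t0 + x) - (\<Sum>k<n. (x ^ k / fact k) *\<^sub>R D k t0)) \<le> C * \<bar>x\<bar> ^ n"
  using assms(2)
proof (induction n arbitrary: D)
  case 0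
  have "isCont (D 0) t0"
    using 0[of t0 0] \<open>\<delta> > 0\<close> by (intro has_vector_derivative_continuous[of _ "D (Suc 0) t0"]) simp
  then have "\<exists>\<eta>>0. \<forall>t. dist t t0 < \<eta> \<longrightarrow> dist (D 0 t) (D 0 t0) < 1"
    by (simp add: continuous_at_eps_delta)
  then obtain \<eta> where "\<eta> > 0" and \<eta>: "\<And>t. dist t t0 < \<eta> \<Longrightarrow> dist (D 0 t) (D 0 t0) < 1"
    by auto
  have "norm (D 0 (t0 + x)) \<le> norm (D 0 t0) + 1" if "\<bar>x\<bar> \<le> \<eta> / 2" for x
  proof -
    have "dist (D 0 (t0 + x)) (D 0 t0) < 1"
      using that \<open>\<eta> > 0\<close> by (intro \<eta>) (simp add: dist_norm)
    then show ?thesis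
      unfolding dist_norm using norm_triangle_sub[of "D 0 (t0 + x)" "D 0 t0"] by linarith
  qed
  then show ?case
    using \<open>\<eta> > 0\<close> by (intro exI[of _ "norm (D 0 t0) + 1"] exI[of _ "\<eta> / 2"]) auto
next
  case (Suc n)
  let ?R = "\<lambda>x. D 0 (t0 + x) - (\<Sum>k<Suc n. (x ^ k / fact k) *\<^sub>R D k t0)"
  let ?R' = "\<lambda>x. D (Suc 0) (t0 + x) - (\<Sum>k<n. (x ^ k / fact k) *\<^sub>R D (Suc k) t0)"
  obtain C\<^sub>0 \<eta> where "\<eta> > 0" and C\<^sub>0: "\<And>x. \<bar>x\<bar> \<le> \<eta> \<Longrightarrow> norm (?R' x) \<le> C\<^sub>0 * \<bar>x\<bar> ^ n"
    using Suc.IH[of "\<lambda>k. D (Suc k)"] Suc.prems by auto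
  define C where "C = \<bar>C\<^sub>0\<bar>"
  have "C \<ge> 0" by (simp add: C_def)
  have C: "norm (?R' x) \<le> C * \<bar>x\<bar> ^ n" if "\<bar>x\<bar> \<le> \<eta>" for x
    using C\<^sub>0[OF that] by (rule order_trans) (simp add: C_def mult_right_mono)
  define \<zeta> where "\<zeta> = min \<eta> (\<delta> / 2)"
  have "\<zeta> > 0" using \<open>\<eta> > 0\<close> \<open>\<delta> > 0\<close> by (simp add: \<zeta>_def)
  have der: "(?R has_vector_derivative ?R' x) (at x)" if "\<bar>x\<bar> \<le> \<zeta>" for x
  proof -
    have "\<bar>t0 + x - t0\<bar> < \<delta>"
      using that \<open>\<delta> > 0\<close> by (auto simp: \<zeta>_def)
    then have "(D 0 has_vector_derivative D (Suc 0) (t0 + x)) (at (t0 + x))"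
      by (rule Suc.prems)
    moreover have "((\<lambda>x. t0 + x) has_vector_derivative 1) (at x)"
      by (auto intro!: derivative_eq_intros)
    ultimately have "((\<lambda>x. D 0 (t0 + x)) has_vector_derivative D (Suc 0) (t0 + x)) (at x)"
      using vector_diff_chain_at[of "\<lambda>x. t0 + x" 1 x "D 0" "D (Suc 0) (t0 + x)"]
      by (simp add: o_def)
    moreover have "((\<lambda>x. \<Sum>k<Suc n. (x ^ k / fact k) *\<^sub>R D k t0) has_vector_derivative
        (\<Sum>k<n. (x ^ k / fact k) *\<^sub>R D (Suc k) t0)) (at x)"
    proof -
      have "((\<lambda>x. (x ^ k / fact k) *\<^sub>R D k t0) has_vector_derivative
          (real k * x ^ (k - 1) / fact k) *\<^sub>R D k t0) (at x)" for k
      proof -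
        have "((\<lambda>x. x ^ k / fact k) has_real_derivative real k * x ^ (k - 1) / fact k) (at x)"
          by (auto intro!: derivative_eq_intros)
        from has_vector_derivative_scaleR[OF this has_vector_derivative_const[of "D k t0"]]
        show ?thesis by simp
      qed
      then have "((\<lambda>x. \<Sum>k<Suc n. (x ^ k / fact k) *\<^sub>R D k t0) has_vector_derivative
        (\<Sum>k<Suc n. (real k * x ^ (k - 1) / fact k) *\<^sub>R D k t0)) (at x)"
        by (intro has_vector_derivative_sum)
      moreover have "(\<Sum>k<Suc n. (real k * x ^ (k - 1) / fact k) *\<^sub>R D k t0)
          = (\<Sum>k<n. (x ^ k / fact k) *\<^sub>R D (Suc k) t0)"
        by (subst sum.lessThan_Suc_shift) (simp del: of_nat_Suc)
      ultimately show ?thesis by (simp only:)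
    qed
    ultimately show ?thesis
      by (rule has_vector_derivative_diff)
  qed
  have "norm (?R x) \<le> C * \<bar>x\<bar> ^ Suc n" if x: "\<bar>x\<bar> \<le> \<zeta>" for x
  proof -
    have "norm (?R x - ?R 0) \<le> C * \<bar>x\<bar> ^ n * norm (x - 0)"
    proof (rule differentiable_bound[of "cball 0 \<bar>x\<bar>"])
      fix z :: real assume "z \<in> cball 0 \<bar>x\<bar>"
      then have z: "\<bar>z\<bar> \<le> \<bar>x\<bar>" by simp
      then have "\<bar>z\<bar> \<le> \<zeta>" "\<bar>z\<bar> \<le> \<eta>" using x by (auto simp: \<zeta>_def)
      show "(?R has_derivative (\<lambda>r. r *\<^sub>R ?R' z)) (at z within cball 0 \<bar>x\<bar>)"
        using der[OF \<open>\<bar>z\<bar> \<le> \<zeta>\<close>] unfolding has_vector_derivative_def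
        by (rule has_derivative_at_withinI)
      have "norm (?R' z) \<le> C * \<bar>x\<bar> ^ n"
        using C[OF \<open>\<bar>z\<bar> \<le> \<eta>\<close>]
        by (rule order_trans) (simp add: mult_left_mono power_mono z \<open>C \<ge> 0\<close>)
      then show "onorm (\<lambda>r. r *\<^sub>R ?R' z) \<le> C * \<bar>x\<bar> ^ n"
        using \<open>C \<ge> 0\<close> by (intro onorm_bound) (auto simp: mult.commute mult_left_mono)
    qed auto
    moreover have "?R 0 = 0"
      by (subst sum.lessThan_Suc_shift) simp
    ultimately show ?thesis
      by (simp add: mult_ac)
  qed
  then show ?case
    using \<open>\<zeta> > 0\<close> by blast
qed

section \<open>Asymptotic equality as the step size tends to 0\<close>

definition eqO :: "nat \<Rightarrow> (real \<Rightarrow> 'a::real_normed_vector) \<Rightarrow> (real \<Rightarrow> 'a) \<Rightarrow> bool" where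
  "eqO n u v \<longleftrightarrow> (\<lambda>h. norm (u h - v h)) \<in> O[at_right 0](\<lambda>h. h ^ n)"

lemma eqO_iff: "eqO n u v \<longleftrightarrow> (\<exists>C. \<forall>\<^sub>F h in at_right 0. norm (u h - v h) \<le> C * h ^ n)"
proof
  assume "eqO n u v"
  then obtain C where "\<forall>\<^sub>F h in at_right 0. norm (norm (u h - v h)) \<le> C * norm (h ^ n)"
    unfolding eqO_def by (rule landau_o.bigE)
  then have "\<forall>\<^sub>F h in at_right 0. norm (u h - v h) \<le> C * h ^ n"
    using eventually_at_right_less[of "0::real"] by eventually_elim simp
  then show "\<exists>C. \<forall>\<^sub>F h in at_right 0. norm (u h - v h) \<le> C * h ^ n" ..
next
  assume "\<exists>C. \<forall>\<^sub>F h in at_right 0. norm (u h - v h) \<le> C * h ^ n"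
  then obtain C where "\<forall>\<^sub>F h in at_right 0. norm (u h - v h) \<le> C * h ^ n" ..
  then have "\<forall>\<^sub>F h in at_right 0. norm (norm (u h - v h)) \<le> C * norm (h ^ n)"
    using eventually_at_right_less[of "0::real"] by eventually_elim simp
  then show "eqO n u v"
    unfolding eqO_def by (rule bigoI)
qed

lemma eqO_I:
  assumes "\<forall>\<^sub>F h in at_right 0. norm (u h - v h) \<le> C * h ^ n"
  shows "eqO n u v"
  using assms eqO_iff by blast

lemma eqO_E:
  assumes "eqO n u v"
  obtains C where "C \<ge> 0" "\<forall>\<^sub>F h in at_right 0. norm (u h - v h) \<le> C * h ^ n"
proof -
  obtain C where C: "\<forall>\<^sub>F h in at_right 0. norm (u h - v h) \<le> C * h ^ n"
    using assms eqO_iff by blast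
  have "\<forall>\<^sub>F h in at_right 0. norm (u h - v h) \<le> \<bar>C\<bar> * h ^ n"
    using C eventually_at_right_less[of "0::real"]
  proof eventually_elim
    case (elim h)
    have "C * h ^ n \<le> \<bar>C\<bar> * h ^ n"
      using elim(2) by (intro mult_right_mono) auto
    with elim(1) show ?case by linarith
  qed
  then show ?thesis
    using that[of "\<bar>C\<bar>"] by simp
qed

lemma eqO_eventually_eq:
  assumes "\<forall>\<^sub>F h in at_right 0. u h = v h"
  shows "eqO n u v"
  by (rule eqO_I[of _ _ 0]) (use assms in eventually_elim, simp)

lemma eqO_refl: "eqO n u u"
  by (simp add: eqO_eventually_eq)

lemma eqO_sym: "eqO n u v \<Longrightarrow> eqO n v u"
  by (simp add: eqO_def norm_minus_commute)

lemma eqO_add: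
  assumes "eqO n u v" "eqO n u' v'"
  shows "eqO n (\<lambda>h. u h + u' h) (\<lambda>h. v h + v' h)"
proof -
  obtain C where "\<forall>\<^sub>F h in at_right 0. norm (u h - v h) \<le> C * h ^ n"
    using assms(1) by (rule eqO_E)
  moreover obtain C' where "\<forall>\<^sub>F h in at_right 0. norm (u' h - v' h) \<le> C' * h ^ n"
    using assms(2) by (rule eqO_E)
  ultimately have "\<forall>\<^sub>F h in at_right 0. norm ((u h + u' h) - (v h + v' h)) \<le> (C + C') * h ^ n"
  proof eventually_elim
    case (elim h)
    then show ?case
      using norm_diff_triangle_ineq[of "u h" "u' h" "v h" "v' h"] by (simp add: distrib_right)
  qed
  then show ?thesis by (rule eqO_I)
qed

lemma eqO_scaleR:
  assumes "eqO n u v"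
  shows "eqO n (\<lambda>h. x *\<^sub>R u h) (\<lambda>h. x *\<^sub>R v h)"
proof -
  obtain C where "\<forall>\<^sub>F h in at_right 0. norm (u h - v h) \<le> C * h ^ n"
    using assms by (rule eqO_E)
  then have "\<forall>\<^sub>F h in at_right 0. norm (x *\<^sub>R u h - x *\<^sub>R v h) \<le> (\<bar>x\<bar> * C) * h ^ n"
  proof eventually_elim
    case (elim h)
    then show ?case
      using mult_left_mono[OF elim, of "\<bar>x\<bar>"]
      by (simp add: scaleR_right_diff_distrib[symmetric] mult.assoc)
  qed
  then show ?thesis by (rule eqO_I)
qed

lemma eqO_diff:
  assumes "eqO n u v" "eqO n u' v'"
  shows "eqO n (\<lambda>h. u h - u' h) (\<lambda>h. v h - v' h)"
  using eqO_add[OF assms(1) eqO_scaleR[OF assms(2), of "-1"]] by simp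

lemma eqO_trans:
  assumes "eqO n u v" "eqO n v w"
  shows "eqO n u w"
proof -
  have "eqO n (\<lambda>h. u h + v h) (\<lambda>h. v h + w h)"
    using assms by (rule eqO_add)
  then show ?thesis
    by (simp add: eqO_def algebra_simps)
qed

lemma eqO_sum:
  assumes "\<And>i. i \<in> I \<Longrightarrow> eqO n (u i) (v i)"
  shows "eqO n (\<lambda>h. \<Sum>i\<in>I. u i h) (\<lambda>h. \<Sum>i\<in>I. v i h)"
  using assms by (induction I rule: infinite_finite_induct) (simp_all add: eqO_refl eqO_add)

lemma eqO_power_scaleR:
  assumes "eqO n u v"
  shows "eqO (k + n) (\<lambda>h. h ^ k *\<^sub>R u h) (\<lambda>h. h ^ k *\<^sub>R v h)"
proof -
  obtain C where "\<forall>\<^sub>F h in at_right 0. norm (u h - v h) \<le> C * h ^ n"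
    using assms by (rule eqO_E)
  then have "\<forall>\<^sub>F h in at_right 0. norm (h ^ k *\<^sub>R u h - h ^ k *\<^sub>R v h) \<le> C * h ^ (k + n)"
    using eventually_at_right_less[of "0::real"]
  proof eventually_elim
    case (elim h)
    then show ?case
      using mult_left_mono[OF elim(1), of "h ^ k"]
      by (simp add: scaleR_right_diff_distrib[symmetric] power_add mult_ac)
  qed
  then show ?thesis by (rule eqO_I)
qed

lemma eqO_mono:
  assumes "eqO m u v" "n \<le> m"
  shows "eqO n u v"
proof -
  obtain C where "C \<ge> 0" "\<forall>\<^sub>F h in at_right 0. norm (u h - v h) \<le> C * h ^ m"
    using assms(1) by (rule eqO_E)
  note this(2)
  moreover have "\<forall>\<^sub>F h in at_right (0::real). h < 1"
    by (rule eventually_mono[OF eventually_at_right_real[of 0 1]]) simp_all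
  ultimately have "\<forall>\<^sub>F h in at_right 0. norm (u h - v h) \<le> C * h ^ n"
    using eventually_at_right_less[of "0::real"]
  proof eventually_elim
    case (elim h)
    have "h ^ m \<le> h ^ n"
      using elim assms(2) by (intro power_decreasing) auto
    from mult_left_mono[OF this \<open>C \<ge> 0\<close>] elim show ?case by linarith
  qed
  then show ?thesis by (rule eqO_I)
qed

lemma eqO_cong_left:
  assumes "\<forall>\<^sub>F h in at_right 0. u h = u' h"
  shows "eqO n u v \<longleftrightarrow> eqO n u' v"
  using eqO_trans[OF eqO_eventually_eq[OF assms]] eqO_trans[OF eqO_sym[OF eqO_eventually_eq[OF assms]]]
  by blast

lemma eqO_diff_0: "eqO n (\<lambda>h. u h - v h) (\<lambda>h. 0) \<longleftrightarrow> eqO n u v"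
  by (simp add: eqO_def)

text \<open>The constant term is the limit as \<open>h\<close> tends to 0, hence zero. Dividing by
  \<open>h > 0\<close> lowers both the degree and the order of the bound by one.\<close>

lemma poly_sum_eqO_zero_imp_coeff_zero:
  fixes a :: "nat \<Rightarrow> real"
  assumes "eqO (Suc p) (\<lambda>h. \<Sum>k\<le>p. a k * h ^ k) (\<lambda>h. 0)"
  shows "k \<le> p \<Longrightarrow> a k = 0"
  using assms
proof (induction p arbitrary: a k)
  have lim: "(\<phi> \<longlongrightarrow> \<phi> 0) (at_right 0)" if "isCont \<phi> 0" for \<phi> :: "real \<Rightarrow> real"
    using that unfolding isCont_def by (rule tendsto_mono[OF at_le, rotated]) simp
  have a0: "a 0 = 0" if a: "eqO (Suc p) (\<lambda>h. \<Sum>k\<le>p. a k * h ^ k) (\<lambda>h. 0)"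
    for p and a :: "nat \<Rightarrow> real"
  proof -
    obtain C where C: "\<forall>\<^sub>F h in at_right 0. norm ((\<Sum>k\<le>p. a k * h ^ k) - 0) \<le> C * h ^ Suc p"
      using a by (rule eqO_E)
    have "((\<lambda>h. \<Sum>k\<le>p. a k * h ^ k) \<longlongrightarrow> 0) (at_right 0)"
    proof (rule Lim_null_comparison)
      show "\<forall>\<^sub>F h in at_right 0. norm (\<Sum>k\<le>p. a k * h ^ k) \<le> C * h ^ Suc p"
        using C by simp
      show "((\<lambda>h. C * h ^ Suc p) \<longlongrightarrow> 0) (at_right 0)"
        using lim[of "\<lambda>h. C * h ^ Suc p"] by simp
    qed
    moreover have "((\<lambda>h. \<Sum>k\<le>p. a k * h ^ k) \<longlongrightarrow> (\<Sum>k\<le>p. a k * 0 ^ k)) (at_right 0)"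
      by (rule lim[of "\<lambda>h. \<Sum>k\<le>p. a k * h ^ k"]) (intro continuous_intros)
    ultimately have "(\<Sum>k\<le>p. a k * 0 ^ k) = 0"
      using tendsto_unique trivial_limit_at_right_real by blast
    moreover have "(\<Sum>k\<le>p. a k * 0 ^ k) = (\<Sum>k\<in>{0}. a k)"
      by (rule sum.mono_neutral_cong_right) auto
    ultimately show ?thesis by simp
  qed
  {
    case 0
    then show ?case using a0[of 0] by simp
  next
    case (Suc p)
    have [simp]: "a 0 = 0" using a0 Suc.prems by blast
    obtain C where "\<forall>\<^sub>F h in at_right 0. norm ((\<Sum>k\<le>Suc p. a k * h ^ k) - 0) \<le> C * h ^ Suc (Suc p)"
      using Suc.prems(2) by (rule eqO_E)
    then have "\<forall>\<^sub>F h in at_right 0. norm ((\<Sum>k\<le>p. a (Suc k) * h ^ k) - 0) \<le> C * h ^ Suc p"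
      using eventually_at_right_less[of "0::real"]
    proof eventually_elim
      case (elim h)
      have "(\<Sum>k\<le>Suc p. a k * h ^ k) = h * (\<Sum>k\<le>p. a (Suc k) * h ^ k)"
        by (subst sum.atMost_Suc_shift) (simp add: sum_distrib_left mult_ac)
      with elim have "h * \<bar>\<Sum>k\<le>p. a (Suc k) * h ^ k\<bar> \<le> h * (C * h ^ Suc p)"
        by (simp add: abs_mult mult_ac)
      with elim(2) show ?case by simp
    qed
    then have "eqO (Suc p) (\<lambda>h. \<Sum>k\<le>p. a (Suc k) * h ^ k) (\<lambda>h. 0)"
      by (rule eqO_I)
    from Suc.IH[OF _ this] show ?case
      using Suc.prems(1) by (cases k) auto
  }
qed

lemma Taylor_eqO:
  fixes D :: "nat \<Rightarrow> real \<Rightarrow> 'a::real_normed_vector"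
  assumes "\<delta> > 0"
    and "\<And>k t. \<bar>t - t0\<bar> < \<delta> \<Longrightarrow> (D k has_vector_derivative D (Suc k) t) (at t)"
  shows "eqO n (\<lambda>h. D 0 (t0 + x * h)) (\<lambda>h. \<Sum>k<n. ((x * h) ^ k / fact k) *\<^sub>R D k t0)"
proof -
  obtain C \<eta> where "\<eta> > 0" and C: "\<And>z. \<bar>z\<bar> \<le> \<eta> \<Longrightarrow>
      norm (D 0 (t0 + z) - (\<Sum>k<n. (z ^ k / fact k) *\<^sub>R D k t0)) \<le> C * \<bar>z\<bar> ^ n"
    using Taylor_remainder_bound[of \<delta> t0 D n, OF assms] by blast
  \<comment> \<open>The summand 1 in the denominator covers \<open>x = 0\<close>.\<close>
  have "\<forall>\<^sub>F h in at_right 0. h \<in> {0<..<\<eta> / (\<bar>x\<bar> + 1)}"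
    using \<open>\<eta> > 0\<close> by (intro eventually_at_right_real) (simp add: add_nonneg_pos)
  then have "\<forall>\<^sub>F h in at_right 0. norm (D 0 (t0 + x * h) - (\<Sum>k<n. ((x * h) ^ k / fact k) *\<^sub>R D k t0)) \<le> (C * \<bar>x\<bar> ^ n) * h ^ n"
  proof eventually_elim
    case (elim h)
    then have "h * (\<bar>x\<bar> + 1) < \<eta>"
      by (simp add: pos_less_divide_eq add_nonneg_pos)
    moreover have "\<bar>x * h\<bar> \<le> h * (\<bar>x\<bar> + 1)"
      using elim by (simp add: abs_mult algebra_simps)
    ultimately show ?case
      using C[of "x * h"] elim by (simp add: abs_mult power_mult_distrib mult_ac)
  qed
  then show ?thesis by (rule eqO_I)
qed

lemma isCont_imp_Bfun:
  fixes u :: "real \<Rightarrow> 'a::real_normed_vector"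
  assumes "isCont u 0"
  shows "Bfun u (at_right 0)"
proof -
  have "(u \<longlongrightarrow> u 0) (at_right 0)"
    using assms unfolding isCont_def by (rule tendsto_mono[OF at_le, rotated]) simp
  then have "\<forall>\<^sub>F h in at_right 0. dist (u h) (u 0) < 1"
    by (rule tendstoD) simp
  then have "\<forall>\<^sub>F h in at_right 0. norm (u h) \<le> norm (u 0) + 1"
  proof eventually_elim
    case (elim h)
    then show ?case
      unfolding dist_norm using norm_triangle_sub[of "u h" "u 0"] by linarith
  qed
  then show ?thesis by (rule BfunI)
qed

text \<open>Here the boundedness demanded in \<open>imex_step\<close> pays off: a smooth field is
  Lipschitz only on bounded sets, and both families eventually stay in a common ball.\<close>

lemma smooth_field_difference_bound:
  assumes g: "smooth_field g" and u: "Bfun u (at_right 0)" and v: "Bfun v (at_right 0)"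
  obtains L where "L \<ge> 0"
    and "\<forall>\<^sub>F h in at_right 0. norm (g (u h) - g (v h)) \<le> L * norm (u h - v h)"
proof -
  obtain A where A: "\<forall>\<^sub>F h in at_right 0. norm (u h) \<le> A"
    using u by (auto simp: Bfun_def)
  obtain B where B: "\<forall>\<^sub>F h in at_right 0. norm (v h) \<le> B"
    using v by (auto simp: Bfun_def)
  obtain L where "L \<ge> 0" and L: "\<And>x z. norm x \<le> max A B \<Longrightarrow> norm z \<le> max A B \<Longrightarrow>
      norm (g x - g z) \<le> L * norm (x - z)"
    using smooth_field_Lipschitz_on_cball[OF g, of "max A B"] by auto
  have "\<forall>\<^sub>F h in at_right 0. norm (g (u h) - g (v h)) \<le> L * norm (u h - v h)"
    using A B by eventually_elim (rule L, auto)
  with \<open>L \<ge> 0\<close> show ?thesis by (rule that)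
qed

lemma eqO_smooth_field:
  assumes g: "smooth_field g" and u: "Bfun u (at_right 0)" and v: "Bfun v (at_right 0)"
    and uv: "eqO n u v"
  shows "eqO n (\<lambda>h. g (u h)) (\<lambda>h. g (v h))"
proof -
  obtain L where "L \<ge> 0"
    and L: "\<forall>\<^sub>F h in at_right 0. norm (g (u h) - g (v h)) \<le> L * norm (u h - v h)"
    using g u v by (rule smooth_field_difference_bound)
  obtain C where C: "\<forall>\<^sub>F h in at_right 0. norm (u h - v h) \<le> C * h ^ n"
    using uv by (rule eqO_E)
  have "\<forall>\<^sub>F h in at_right 0. norm (g (u h) - g (v h)) \<le> (L * C) * h ^ n"
    using L C
  proof eventually_elim
    case (elim h)
    have "L * norm (u h - v h) \<le> L * (C * h ^ n)"
      by (rule mult_left_mono[OF elim(2) \<open>L \<ge> 0\<close>])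
    with elim(1) show ?case by (simp add: mult.assoc)
  qed
  then show ?thesis by (rule eqO_I)
qed

section \<open>Expansions in elementary weights\<close>

definition tmon :: "real \<Rightarrow> nat \<Rightarrow> real" where
  "tmon x k = x ^ k / fact k"

text \<open>The derivative of \<open>tmon\<close> in \<open>x\<close>, that is, the entries of
  \<open>C K\<close> for the matrices \<open>C\<close> and \<open>K\<close> of the known order
  conditions. The case \<open>k = 0\<close> is split off because truncated subtraction would yield 1
  there.\<close>

definition tmon_deriv :: "real \<Rightarrow> nat \<Rightarrow> real" where
  "tmon_deriv x k = (if k = 0 then 0 else tmon x (k - 1))"

text \<open>The row vector \<open>a E\<close>, with \<open>E\<close> the exponential of the shift matrix.\<close>

definition shift_coeff :: "(nat \<Rightarrow> real) \<Rightarrow> nat \<Rightarrow> real" where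
  "shift_coeff a k = (\<Sum>l\<le>k. a l / fact (k - l))"

lemma shift_coeff_cong:
  assumes "\<And>l. l \<le> k \<Longrightarrow> a l = b l"
  shows "shift_coeff a k = shift_coeff b k"
  using assms by (simp add: shift_coeff_def)

text \<open>Index 0 weights \<open>y\<close> itself and index \<open>Suc m\<close> the derivative of
  order \<open>m\<close> of a field along the solution. The two kinds of terms are expanded
  separately and recombine in this form.\<close>

lemma shift_coeff_split:
  assumes "k \<le> p"
  shows "shift_coeff a k = a 0 * tmon 1 k
    + (\<Sum>m<p. a (Suc m) * (if m < k then tmon 1 (k - Suc m) else 0))"
proof -
  have "shift_coeff a k = a 0 / fact k + (\<Sum>m<k. a (Suc m) / fact (k - Suc m))"
    by (simp add: shift_coeff_def sum.atMost_shift)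
  also have "(\<Sum>m<k. a (Suc m) / fact (k - Suc m))
      = (\<Sum>m<p. a (Suc m) * (if m < k then tmon 1 (k - Suc m) else 0))"
    using assms by (intro sum.mono_neutral_cong_left) (auto simp: tmon_def)
  finally show ?thesis by (simp add: tmon_def)
qed

section \<open>Expansions along one fixed smooth solution\<close>

locale smooth_trajectory =
  fixes f g :: "'a::euclidean_space \<Rightarrow> 'a" and y :: "real \<Rightarrow> 'a" and t0 :: real and p :: nat
  assumes smooth_f: "smooth_field f" and smooth_g: "smooth_field g"
    and solution: "ode_solution_near f g y t0"
begin

abbreviation Fd :: "nat \<Rightarrow> real \<Rightarrow> 'a" where "Fd k \<equiv> nth_vderiv k (\<lambda>\<tau>. f (y \<tau>))"
abbreviation Gd :: "nat \<Rightarrow> real \<Rightarrow> 'a" where "Gd k \<equiv> nth_vderiv k (\<lambda>\<tau>. g (y \<tau>))"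

text \<open>A weight expansion detached from matrices, so that expansions form a linear space of
  coefficient sequences. The coefficient of \<open>y\<close> is common to both families, as it is
  for \<open>W\<close> and \<open>Wh\<close>, and is read from \<open>a\<close>.\<close>

definition wexp :: "(nat \<Rightarrow> real) \<Rightarrow> (nat \<Rightarrow> real) \<Rightarrow> real \<Rightarrow> 'a" where
  "wexp a b h = a 0 *\<^sub>R y t0
    + (\<Sum>k<p. h ^ Suc k *\<^sub>R (a (Suc k) *\<^sub>R Fd k t0 + b (Suc k) *\<^sub>R Gd k t0))"

lemma weight_expansion_shift:
  "weight_expansion p W Wh f g y h t i = W $$ (i, 0) *\<^sub>R y t
    + (\<Sum>k<p. W $$ (i, Suc k) *\<^sub>R (h ^ Suc k *\<^sub>R Fd k t))
    + (\<Sum>k<p. Wh $$ (i, Suc k) *\<^sub>R (h ^ Suc k *\<^sub>R Gd k t))"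
  by (simp add: weight_expansion_def sum.atLeast1_atMost_eq)

lemma weight_expansion_eq_wexp:
  "weight_expansion p W Wh f g y h t0 i = wexp (\<lambda>k. W $$ (i, k)) (\<lambda>k. Wh $$ (i, k)) h"
  by (simp add: weight_expansion_shift wexp_def scaleR_add_right sum.distrib mult.commute)

lemma wexp_add: "wexp a b h + wexp a' b' h = wexp (\<lambda>k. a k + a' k) (\<lambda>k. b k + b' k) h"
  by (simp add: wexp_def scaleR_add_left scaleR_add_right sum.distrib del: power_Suc)

lemma wexp_scaleR: "x *\<^sub>R wexp a b h = wexp (\<lambda>k. x * a k) (\<lambda>k. x * b k) h"
  by (simp add: wexp_def scaleR_add_right scaleR_sum_right mult_ac del: power_Suc)

lemma wexp_diff: "wexp a b h - wexp a' b' h = wexp (\<lambda>k. a k - a' k) (\<lambda>k. b k - b' k) h"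
  using wexp_add[of a b h "\<lambda>k. (-1) * a' k" "\<lambda>k. (-1) * b' k"] wexp_scaleR[of "-1" a' b' h]
  by (simp add: diff_conv_add_uminus del: add_uminus_conv_diff)

lemma wexp_sum:
  "(\<Sum>j\<in>J. x j *\<^sub>R wexp (a j) (b j) h) = wexp (\<lambda>k. \<Sum>j\<in>J. x j * a j k) (\<lambda>k. \<Sum>j\<in>J. x j * b j k) h"
proof (induction J rule: infinite_finite_induct)
  case (insert j J)
  then show ?case by (simp add: wexp_scaleR wexp_add)
qed (simp_all add: wexp_def)

lemma wexp_cong:
  assumes "\<And>k. k \<le> p \<Longrightarrow> a k = a' k" "\<And>k. k \<le> p \<Longrightarrow> b k = b' k"
  shows "wexp a b h = wexp a' b' h"
  using assms by (simp add: wexp_def)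

lemma solution_near:
  obtains \<delta> where "\<delta> > 0"
    and "\<And>t. \<bar>t - t0\<bar> < \<delta> \<Longrightarrow> (y has_vector_derivative f (y t) + g (y t)) (at t)"
  using solution unfolding ode_solution_near_def eventually_nhds_metric dist_real_def by auto

lemma nth_vderiv_field_derivative:
  assumes y: "\<And>t. \<bar>t - t0\<bar> < \<delta> \<Longrightarrow> (y has_vector_derivative f (y t) + g (y t)) (at t)"
    and \<phi>: "smooth_field \<phi>" and t: "\<bar>t - t0\<bar> < \<delta>"
  shows "(nth_vderiv k (\<lambda>\<tau>. \<phi> (y \<tau>)) has_vector_derivative
    nth_vderiv (Suc k) (\<lambda>\<tau>. \<phi> (y \<tau>)) t) (at t)"
proof (rule nth_vderiv_has_vector_derivative[where S = "ball t0 \<delta>" and F = "\<lambda>x. f x + g x"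
      and \<phi> = \<phi> and y = y])
  show "ntimes_cont_diff n (\<lambda>x. f x + g x)" for n
    using smooth_f smooth_g by (intro ntimes_cont_diff_add) (auto simp: smooth_field_def)
  show "ntimes_cont_diff n \<phi>" for n
    using \<phi> by (simp add: smooth_field_def)
qed (use y t in \<open>auto simp: dist_real_def abs_minus_commute\<close>)

lemma Bfun_solution: "Bfun (\<lambda>h. y (t0 + x * h)) (at_right 0)"
proof -
  obtain \<delta> where "\<delta> > 0"
    and \<delta>: "\<And>t. \<bar>t - t0\<bar> < \<delta> \<Longrightarrow> (y has_vector_derivative f (y t) + g (y t)) (at t)"
    by (rule solution_near) (rule that)
  have "isCont y (t0 + x * 0)"
    using has_vector_derivative_continuous[OF \<delta>] \<open>\<delta> > 0\<close> by simp
  then have "isCont (\<lambda>h. y (t0 + x * h)) 0"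
    by (intro isCont_o2[of 0 "\<lambda>h. t0 + x * h" y]) auto
  then show ?thesis by (rule isCont_imp_Bfun)
qed

lemma solution_expansion: "eqO (Suc p) (\<lambda>h. y (t0 + x * h)) (wexp (tmon x) (tmon x))"
proof -
  obtain \<delta> where "\<delta> > 0"
    and \<delta>: "\<And>t. \<bar>t - t0\<bar> < \<delta> \<Longrightarrow> (y has_vector_derivative f (y t) + g (y t)) (at t)"
    by (rule solution_near) (rule that)
  \<comment> \<open>The differential equation turns derivatives of \<open>y\<close> into derivatives
    of both fields with equal coefficients, which is why \<open>tmon x\<close> occurs twice in the
    expansion.\<close>
  define D where "D k t = (case k of 0 \<Rightarrow> y t | Suc m \<Rightarrow> Fd m t + Gd m t)" for k t
  have D0: "D 0 = y" and DS: "D (Suc m) = (\<lambda>t. Fd m t + Gd m t)" for m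
    by (auto simp: D_def)
  have "(D k has_vector_derivative D (Suc k) t) (at t)" if t: "\<bar>t - t0\<bar> < \<delta>" for k t
  proof (cases k)
    case 0
    with \<delta>[OF t] show ?thesis by (simp add: D0 DS nth_vderiv_def)
  next
    case (Suc m)
    show ?thesis
      unfolding Suc DS
      by (intro has_vector_derivative_add nth_vderiv_field_derivative[OF \<delta> _ t] smooth_f smooth_g)
  qed
  from Taylor_eqO[of \<delta> t0 D "Suc p" x, OF \<open>\<delta> > 0\<close> this]
  have "eqO (Suc p) (\<lambda>h. y (t0 + x * h)) (\<lambda>h. \<Sum>k<Suc p. ((x * h) ^ k / fact k) *\<^sub>R D k t0)"
    by (simp only: D0)
  moreover have "(\<Sum>k<Suc p. ((x * h) ^ k / fact k) *\<^sub>R D k t0) = wexp (tmon x) (tmon x) h" for h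
    by (subst sum.lessThan_Suc_shift)
       (simp add: wexp_def D0 DS tmon_def power_mult_distrib scaleR_add_right mult_ac
         del: fact_Suc power_Suc)
  ultimately show ?thesis by simp
qed

text \<open>The prefactor of degree \<open>Suc m\<close> already supplies that many orders, so a
  Taylor polynomial with \<open>p - m\<close> terms suffices. The sum is padded with zeros to the
  index range of \<open>wexp\<close>.\<close>

lemma shifted_Taylor:
  assumes \<phi>: "smooth_field \<phi>" and "m < p"
  defines "D \<equiv> \<lambda>k. nth_vderiv k (\<lambda>\<tau>. \<phi> (y \<tau>))"
  shows "eqO (Suc p) (\<lambda>h. h ^ Suc m *\<^sub>R D m (t0 + x * h))
    (\<lambda>h. \<Sum>k<p. h ^ Suc k *\<^sub>R ((if m < Suc k then tmon x (k - m) else 0) *\<^sub>R D k t0))"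
proof -
  obtain \<delta> where "\<delta> > 0"
    and \<delta>: "\<And>t. \<bar>t - t0\<bar> < \<delta> \<Longrightarrow> (y has_vector_derivative f (y t) + g (y t)) (at t)"
    by (rule solution_near) (rule that)
  have "(D (m + k) has_vector_derivative D (m + Suc k) t) (at t)" if "\<bar>t - t0\<bar> < \<delta>" for k t
    using nth_vderiv_field_derivative[OF \<delta> \<phi> that] by (simp add: D_def)
  then have "eqO (p - m) (\<lambda>h. D (m + 0) (t0 + x * h))
      (\<lambda>h. \<Sum>k<p - m. ((x * h) ^ k / fact k) *\<^sub>R D (m + k) t0)"
    by (intro Taylor_eqO[OF \<open>\<delta> > 0\<close>, of t0 "\<lambda>k. D (m + k)"])
  from eqO_power_scaleR[OF this, of "Suc m"]
  have "eqO (Suc p) (\<lambda>h. h ^ Suc m *\<^sub>R D m (t0 + x * h))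
      (\<lambda>h. h ^ Suc m *\<^sub>R (\<Sum>k<p - m. ((x * h) ^ k / fact k) *\<^sub>R D (m + k) t0))"
    using \<open>m < p\<close> by simp
  moreover have "h ^ Suc m *\<^sub>R (\<Sum>k<p - m. ((x * h) ^ k / fact k) *\<^sub>R D (m + k) t0)
      = (\<Sum>k<p. h ^ Suc k *\<^sub>R ((if m < Suc k then tmon x (k - m) else 0) *\<^sub>R D k t0))" for h
  proof -
    have "(\<Sum>k<p. h ^ Suc k *\<^sub>R ((if m < Suc k then tmon x (k - m) else 0) *\<^sub>R D k t0))
        = (\<Sum>k=m..<p. h ^ Suc k *\<^sub>R (tmon x (k - m) *\<^sub>R D k t0))"
      by (intro sum.mono_neutral_cong_right) auto
    also have "\<dots> = (\<Sum>k<p - m. h ^ Suc (m + k) *\<^sub>R (tmon x k *\<^sub>R D (m + k) t0))"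
      by (subst sum.atLeastLessThan_shift_0) (simp add: o_def atLeast0LessThan)
    also have "\<dots> = h ^ Suc m *\<^sub>R (\<Sum>k<p - m. ((x * h) ^ k / fact k) *\<^sub>R D (m + k) t0)"
      by (simp add: scaleR_sum_right tmon_def power_mult_distrib power_add mult_ac)
    finally show ?thesis by simp
  qed
  ultimately show ?thesis by simp
qed

lemma f_expansion:
  assumes "m < p"
  shows "eqO (Suc p) (\<lambda>h. h ^ Suc m *\<^sub>R Fd m (t0 + x * h))
    (wexp (\<lambda>k. if m < k then tmon x (k - Suc m) else 0) (\<lambda>k. 0))"
  using shifted_Taylor[OF smooth_f assms, of x] by (simp add: wexp_def[abs_def] del: power_Suc cong: if_cong)

lemma g_expansion:
  assumes "m < p"
  shows "eqO (Suc p) (\<lambda>h. h ^ Suc m *\<^sub>R Gd m (t0 + x * h))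
    (wexp (\<lambda>k. 0) (\<lambda>k. if m < k then tmon x (k - Suc m) else 0))"
  using shifted_Taylor[OF smooth_g assms, of x] by (simp add: wexp_def[abs_def] del: power_Suc cong: if_cong)

lemma stage_f_expansion:
  assumes "p > 0"
  shows "eqO (Suc p) (\<lambda>h. h *\<^sub>R f (y (t0 + x * h))) (wexp (tmon_deriv x) (\<lambda>k. 0))"
proof -
  have "(\<lambda>k. if 0 < k then tmon x (k - Suc 0) else 0) = tmon_deriv x"
    by (auto simp: tmon_deriv_def)
  with f_expansion[OF assms, of x] show ?thesis
    by (simp add: nth_vderiv_def)
qed

lemma stage_g_expansion:
  assumes "p > 0"
  shows "eqO (Suc p) (\<lambda>h. h *\<^sub>R g (y (t0 + x * h))) (wexp (\<lambda>k. 0) (tmon_deriv x))"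
proof -
  have "(\<lambda>k. if 0 < k then tmon x (k - Suc 0) else 0) = tmon_deriv x"
    by (auto simp: tmon_deriv_def)
  with g_expansion[OF assms, of x] show ?thesis
    by (simp add: nth_vderiv_def)
qed

text \<open>Expanding \<open>y\<close> at the new time feeds its coefficient into the terms of both
  fields. The terms of \<open>g\<close> therefore combine to the shift of the row of
  \<open>Wh\<close> exactly because the two rows share their first entry.\<close>

lemma next_weight_expansion:
  assumes "W $$ (i, 0) = Wh $$ (i, 0)"
  shows "eqO (Suc p) (\<lambda>h. weight_expansion p W Wh f g y h (t0 + h) i)
    (wexp (shift_coeff (\<lambda>k. W $$ (i, k))) (shift_coeff (\<lambda>k. Wh $$ (i, k))))"
proof -
  let ?a = "\<lambda>k. W $$ (i, k)" and ?b = "\<lambda>k. Wh $$ (i, k)"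
  let ?e = "\<lambda>m k. if m < k then tmon 1 (k - Suc m) else 0"
  have "eqO (Suc p) (\<lambda>h. weight_expansion p W Wh f g y h (t0 + 1 * h) i)
    (\<lambda>h. ?a 0 *\<^sub>R wexp (tmon 1) (tmon 1) h
      + (\<Sum>m<p. ?a (Suc m) *\<^sub>R wexp (?e m) (\<lambda>k. 0) h)
      + (\<Sum>m<p. ?b (Suc m) *\<^sub>R wexp (\<lambda>k. 0) (?e m) h))"
    unfolding weight_expansion_shift
    by (intro eqO_add eqO_sum eqO_scaleR solution_expansion f_expansion g_expansion) auto
  moreover have "?a 0 *\<^sub>R wexp (tmon 1) (tmon 1) h
      + (\<Sum>m<p. ?a (Suc m) *\<^sub>R wexp (?e m) (\<lambda>k. 0) h)
      + (\<Sum>m<p. ?b (Suc m) *\<^sub>R wexp (\<lambda>k. 0) (?e m) h)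
      = wexp (shift_coeff ?a) (shift_coeff ?b) h" for h
    unfolding wexp_sum unfolding wexp_scaleR wexp_add
    by (rule wexp_cong) (simp_all add: shift_coeff_split assms)
  ultimately show ?thesis by simp
qed

end

section \<open>One step of a parallel method\<close>

context smooth_trajectory
begin

text \<open>Only \<open>g\<close> at the exact solution is expanded; the difference of the two
  values of \<open>g\<close> is kept. It can then be absorbed when accuracy is to be proved and
  estimated when accuracy is given.\<close>

lemma stage_defect:
  assumes "p > 0"
    and stage: "\<forall>\<^sub>F h in at_right 0. Y h = (h * lam) *\<^sub>R g (Y h) + z h"
    and z: "eqO (Suc p) z (wexp a b)"
  shows "eqO (Suc p) (\<lambda>h. Y h - y (t0 + x * h))
    (\<lambda>h. (h * lam) *\<^sub>R (g (Y h) - g (y (t0 + x * h)))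
      + wexp (\<lambda>k. a k - tmon x k) (\<lambda>k. b k - (tmon x k - lam * tmon_deriv x k)) h)"
proof -
  have "eqO (Suc p) (\<lambda>h. z h - y (t0 + x * h) + lam *\<^sub>R (h *\<^sub>R g (y (t0 + x * h))))
      (\<lambda>h. wexp a b h - wexp (tmon x) (tmon x) h + lam *\<^sub>R wexp (\<lambda>k. 0) (tmon_deriv x) h)"
    by (intro eqO_add eqO_diff eqO_scaleR z solution_expansion stage_g_expansion \<open>p > 0\<close>)
  moreover have "wexp a b h - wexp (tmon x) (tmon x) h + lam *\<^sub>R wexp (\<lambda>k. 0) (tmon_deriv x) h
      = wexp (\<lambda>k. a k - tmon x k) (\<lambda>k. b k - (tmon x k - lam * tmon_deriv x k)) h" for h
    by (simp add: wexp_diff wexp_scaleR wexp_add algebra_simps)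
  ultimately have "eqO (Suc p)
      (\<lambda>h. (h * lam) *\<^sub>R (g (Y h) - g (y (t0 + x * h)))
        + (z h - y (t0 + x * h) + lam *\<^sub>R (h *\<^sub>R g (y (t0 + x * h)))))
      (\<lambda>h. (h * lam) *\<^sub>R (g (Y h) - g (y (t0 + x * h)))
        + wexp (\<lambda>k. a k - tmon x k) (\<lambda>k. b k - (tmon x k - lam * tmon_deriv x k)) h)"
    by (intro eqO_add eqO_refl) simp
  moreover have "\<forall>\<^sub>F h in at_right 0. Y h - y (t0 + x * h)
      = (h * lam) *\<^sub>R (g (Y h) - g (y (t0 + x * h)))
        + (z h - y (t0 + x * h) + lam *\<^sub>R (h *\<^sub>R g (y (t0 + x * h))))"
    using stage
  proof eventually_elim
    case (elim h)
    then have "z h = Y h - (h * lam) *\<^sub>R g (Y h)"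
      by (simp add: eq_diff_eq add.commute)
    then show ?case
      by (simp add: scaleR_right_diff_distrib mult.commute)
  qed
  ultimately show ?thesis
    by (simp only: eqO_cong_left)
qed

lemma stage_order_sufficient:
  assumes "p > 0"
    and stage: "\<forall>\<^sub>F h in at_right 0. Y h = (h * lam) *\<^sub>R g (Y h) + z h"
    and z: "eqO (Suc p) z (wexp a b)" and Y: "Bfun Y (at_right 0)"
    and a: "\<And>k. k \<le> p \<Longrightarrow> a k = tmon x k"
    and b: "\<And>k. k \<le> p \<Longrightarrow> b k = tmon x k - lam * tmon_deriv x k"
  shows "eqO (Suc p) Y (\<lambda>h. y (t0 + x * h))"
proof -
  have "wexp (\<lambda>k. a k - tmon x k) (\<lambda>k. b k - (tmon x k - lam * tmon_deriv x k)) h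
      = wexp (\<lambda>k. 0) (\<lambda>k. 0) h" for h
    by (rule wexp_cong) (simp_all add: a b)
  then have "wexp (\<lambda>k. a k - tmon x k) (\<lambda>k. b k - (tmon x k - lam * tmon_deriv x k)) h = 0" for h
    by (simp add: wexp_def)
  with stage_defect[OF assms(1-3), of x]
  have "eqO (Suc p) (\<lambda>h. Y h - y (t0 + x * h)) (\<lambda>h. (h * lam) *\<^sub>R (g (Y h) - g (y (t0 + x * h))))"
    by simp
  then obtain C where C: "\<forall>\<^sub>F h in at_right 0. norm (Y h - y (t0 + x * h)
      - (h * lam) *\<^sub>R (g (Y h) - g (y (t0 + x * h)))) \<le> C * h ^ Suc p"
    by (rule eqO_E)
  obtain L where "L \<ge> 0" and L: "\<forall>\<^sub>F h in at_right 0.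
      norm (g (Y h) - g (y (t0 + x * h))) \<le> L * norm (Y h - y (t0 + x * h))"
    by (rule smooth_field_difference_bound[OF smooth_g Y Bfun_solution])
  \<comment> \<open>For \<open>h < 1 / D\<close> the nonlinear term costs at most half of the error
    and can be moved to the left, which doubles the constant \<open>C\<close>. The added 1 keeps
    \<open>D\<close> positive when \<open>lam\<close> or \<open>L\<close> vanishes.\<close>
  define D where "D = 2 * (\<bar>lam\<bar> * L + 1)"
  have "D > 0"
    using \<open>L \<ge> 0\<close> by (simp add: D_def add_nonneg_pos)
  then have "\<forall>\<^sub>F h in at_right 0. h \<in> {0<..<1 / D}"
    by (intro eventually_at_right_real) simp
  with C L have "\<forall>\<^sub>F h in at_right 0. norm (Y h - y (t0 + x * h)) \<le> (2 * C) * h ^ Suc p"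
  proof eventually_elim
    case (elim h)
    define E where "E = norm (Y h - y (t0 + x * h))"
    have "E \<ge> 0" by (simp add: E_def)
    have "norm ((h * lam) *\<^sub>R (g (Y h) - g (y (t0 + x * h)))) \<le> (h * \<bar>lam\<bar>) * (L * E)"
      using elim(2,3) by (simp add: abs_mult E_def mult_left_mono)
    also have "\<dots> = (h * (\<bar>lam\<bar> * L)) * E"
      by (simp add: mult_ac)
    also have "\<dots> \<le> (1 / 2) * E"
    proof (rule mult_right_mono[OF _ \<open>E \<ge> 0\<close>])
      have "h * D < 1"
        using elim(3) \<open>D > 0\<close> by (simp add: pos_less_divide_eq)
      then show "h * (\<bar>lam\<bar> * L) \<le> 1 / 2"
        using elim(3) by (simp add: D_def algebra_simps)
    qed
    finally have "norm ((h * lam) *\<^sub>R (g (Y h) - g (y (t0 + x * h)))) \<le> E / 2"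
      by simp
    moreover have "E \<le> norm (Y h - y (t0 + x * h) - (h * lam) *\<^sub>R (g (Y h) - g (y (t0 + x * h))))
        + norm ((h * lam) *\<^sub>R (g (Y h) - g (y (t0 + x * h))))"
      unfolding E_def by (metis diff_add_cancel norm_triangle_ineq)
    ultimately show ?case
      using elim(1) unfolding E_def by linarith
  qed
  then show ?thesis by (rule eqO_I)
qed

lemma eqO_field_term:
  assumes \<phi>: "smooth_field \<phi>" and Y: "Bfun Y (at_right 0)"
    and eq: "eqO (Suc p) Y (\<lambda>h. y (t0 + x * h))"
  shows "eqO (Suc p) (\<lambda>h. h *\<^sub>R \<phi> (Y h)) (\<lambda>h. h *\<^sub>R \<phi> (y (t0 + x * h)))"
  using eqO_mono[OF eqO_power_scaleR[OF eqO_smooth_field[OF \<phi> Y Bfun_solution eq], of 1], of "Suc p"]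
  by simp

text \<open>Once the stage is accurate, the Lipschitz bound makes the difference of the two values
  of \<open>g\<close> negligible too, so the explicit part of the defect must be negligible by
  itself.\<close>

lemma stage_order_necessary:
  assumes "p > 0"
    and stage: "\<forall>\<^sub>F h in at_right 0. Y h = (h * lam) *\<^sub>R g (Y h) + z h"
    and z: "eqO (Suc p) z (wexp a b)" and Y: "Bfun Y (at_right 0)"
    and eq: "eqO (Suc p) Y (\<lambda>h. y (t0 + x * h))"
  shows "eqO (Suc p) (wexp (\<lambda>k. a k - tmon x k) (\<lambda>k. b k - (tmon x k - lam * tmon_deriv x k)))
    (\<lambda>h. 0)"
proof -
  let ?w = "wexp (\<lambda>k. a k - tmon x k) (\<lambda>k. b k - (tmon x k - lam * tmon_deriv x k))"
  let ?G = "\<lambda>h. (h * lam) *\<^sub>R (g (Y h) - g (y (t0 + x * h)))"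
  have "eqO (Suc p) (\<lambda>h. lam *\<^sub>R (h *\<^sub>R g (Y h) - h *\<^sub>R g (y (t0 + x * h))))
    (\<lambda>h. lam *\<^sub>R (h *\<^sub>R g (y (t0 + x * h)) - h *\<^sub>R g (y (t0 + x * h))))"
    by (intro eqO_scaleR eqO_diff eqO_refl eqO_field_term smooth_g Y eq)
  then have G: "eqO (Suc p) ?G (\<lambda>h. 0)"
    by (simp add: scaleR_right_diff_distrib mult.commute)
  have "eqO (Suc p) (\<lambda>h. Y h - y (t0 + x * h)) (\<lambda>h. 0)"
    using eq by (simp only: eqO_diff_0)
  from eqO_trans[OF eqO_sym[OF stage_defect[OF assms(1-3), of x]] this]
  have "eqO (Suc p) (\<lambda>h. ?G h + ?w h) (\<lambda>h. 0)" .
  from eqO_diff[OF this G] show ?thesis by simp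
qed

lemma output_expansion:
  fixes s r :: nat
  assumes "p > 0"
    and Y: "\<And>j. j < s \<Longrightarrow> Bfun (\<lambda>h. Y h j) (at_right 0)"
      "\<And>j. j < s \<Longrightarrow> eqO (Suc p) (\<lambda>h. Y h j) (\<lambda>h. y (t0 + c j * h))"
    and z: "\<And>j. j < r \<Longrightarrow> eqO (Suc p) (\<lambda>h. z h j) (wexp (a j) (b j))"
  shows "eqO (Suc p)
    (\<lambda>h. h *\<^sub>R (\<Sum>j<s. \<beta> j *\<^sub>R f (Y h j) + \<gamma> j *\<^sub>R g (Y h j)) + (\<Sum>j<r. v j *\<^sub>R z h j))
    (wexp (\<lambda>k. (\<Sum>j<s. \<beta> j * tmon_deriv (c j) k) + (\<Sum>j<r. v j * a j k))
          (\<lambda>k. (\<Sum>j<s. \<gamma> j * tmon_deriv (c j) k) + (\<Sum>j<r. v j * b j k)))"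
proof -
  have "eqO (Suc p) (\<lambda>h. h *\<^sub>R f (Y h j)) (wexp (tmon_deriv (c j)) (\<lambda>k. 0))" if "j < s" for j
    by (rule eqO_trans[OF eqO_field_term[OF smooth_f Y[OF that]] stage_f_expansion[OF \<open>p > 0\<close>]])
  moreover have "eqO (Suc p) (\<lambda>h. h *\<^sub>R g (Y h j)) (wexp (\<lambda>k. 0) (tmon_deriv (c j)))" if "j < s" for j
    by (rule eqO_trans[OF eqO_field_term[OF smooth_g Y[OF that]] stage_g_expansion[OF \<open>p > 0\<close>]])
  ultimately have "eqO (Suc p)
    (\<lambda>h. (\<Sum>j<s. \<beta> j *\<^sub>R (h *\<^sub>R f (Y h j))) + (\<Sum>j<s. \<gamma> j *\<^sub>R (h *\<^sub>R g (Y h j)))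
       + (\<Sum>j<r. v j *\<^sub>R z h j))
    (\<lambda>h. (\<Sum>j<s. \<beta> j *\<^sub>R wexp (tmon_deriv (c j)) (\<lambda>k. 0) h)
       + (\<Sum>j<s. \<gamma> j *\<^sub>R wexp (\<lambda>k. 0) (tmon_deriv (c j)) h) + (\<Sum>j<r. v j *\<^sub>R wexp (a j) (b j) h))"
    using z by (intro eqO_add eqO_sum eqO_scaleR) auto
  then show ?thesis
    by (simp add: wexp_sum wexp_add scaleR_sum_right sum.distrib scaleR_add_right mult.commute)
qed

end

section \<open>Linear test problems\<close>

lemma nth_vderiv_exp_scaleR: "nth_vderiv k (\<lambda>t. x *\<^sub>R exp t *\<^sub>R e) = (\<lambda>t. x *\<^sub>R exp t *\<^sub>R e)"
proof (induction k)
  case (Suc k)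
  have "((\<lambda>t. x *\<^sub>R exp t *\<^sub>R e) has_vector_derivative x *\<^sub>R exp t *\<^sub>R e) (at t)" for t
    using has_vector_derivative_scaleR[OF DERIV_exp has_vector_derivative_const[of "x *\<^sub>R e"]]
    by (simp add: mult.commute)
  then have "vector_derivative (\<lambda>t. x *\<^sub>R exp t *\<^sub>R e) (at t) = x *\<^sub>R exp t *\<^sub>R e" for t
    by (rule vector_derivative_at)
  then show ?case
    using Suc by (simp add: nth_vderiv_def)
qed (simp add: nth_vderiv_def)

lemma smooth_field_scaleR: "smooth_field (\<lambda>x. \<beta> *\<^sub>R x)"
  unfolding smooth_field_def by (intro allI ntimes_cont_diff_linear bounded_linear_scaleR_right)

text \<open>The split linear problems \<open>y' = (1 - \<beta>) y + \<beta> y\<close> with \<open>\<beta> \<in> {0, 1}\<close> already detect every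
  order condition, because the solution and all its derivatives agree at the starting point, so the
  conditions are separated by powers of the step size alone.\<close>

lemma smooth_trajectory_exp:
  "smooth_trajectory (\<lambda>x. (1 - \<beta>) *\<^sub>R x) (\<lambda>x. \<beta> *\<^sub>R x) (\<lambda>t. exp t *\<^sub>R e) 0"
proof
  have "((\<lambda>t. exp t *\<^sub>R e) has_vector_derivative exp t *\<^sub>R e) (at t)" for t
    using has_vector_derivative_scaleR[OF DERIV_exp has_vector_derivative_const[of e]] by simp
  then show "ode_solution_near (\<lambda>x. (1 - \<beta>) *\<^sub>R x) (\<lambda>x. \<beta> *\<^sub>R x) (\<lambda>t. exp t *\<^sub>R e) 0"
    by (simp add: ode_solution_near_def scaleR_add_left[symmetric] left_diff_distrib)
qed (rule smooth_field_scaleR)+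

lemma wexp_exp:
  "smooth_trajectory.wexp (\<lambda>x. (1 - \<beta>) *\<^sub>R x) (\<lambda>x. \<beta> *\<^sub>R x) (\<lambda>t. exp t *\<^sub>R e) 0 p a b h
    = (\<Sum>k\<le>p. (if k = 0 then a 0 else (1 - \<beta>) * a k + \<beta> * b k) * h ^ k) *\<^sub>R e"
proof -
  interpret smooth_trajectory "\<lambda>x. (1 - \<beta>) *\<^sub>R x" "\<lambda>x. \<beta> *\<^sub>R x" "\<lambda>t. exp t *\<^sub>R e" 0 p
    by (rule smooth_trajectory_exp)
  show ?thesis
    unfolding wexp_def nth_vderiv_exp_scaleR
    by (simp add: sum.atMost_shift scaleR_sum_left algebra_simps del: power_Suc)
qed

lemma wexp_exp_eqO_zero_imp:
  assumes "e \<noteq> 0"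
    and "eqO (Suc p) (smooth_trajectory.wexp (\<lambda>x. (1 - \<beta>) *\<^sub>R x) (\<lambda>x. \<beta> *\<^sub>R x)
      (\<lambda>t. exp t *\<^sub>R e) 0 p a b) (\<lambda>h. 0)"
    and "k \<le> p"
  shows "(if k = 0 then a 0 else (1 - \<beta>) * a k + \<beta> * b k) = 0"
proof -
  let ?q = "\<lambda>h. \<Sum>k\<le>p. (if k = 0 then a 0 else (1 - \<beta>) * a k + \<beta> * b k) * h ^ k"
  obtain C where "\<forall>\<^sub>F h in at_right 0. norm (?q h *\<^sub>R e - 0) \<le> C * h ^ Suc p"
    using assms(2) unfolding wexp_exp[abs_def] by (rule eqO_E)
  then have "\<forall>\<^sub>F h in at_right 0. norm (?q h - 0) \<le> (C / norm e) * h ^ Suc p"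
    by eventually_elim (use \<open>e \<noteq> 0\<close> in \<open>simp add: pos_le_divide_eq\<close>)
  then have "eqO (Suc p) ?q (\<lambda>h. 0)"
    by (rule eqO_I)
  then show ?thesis
    using \<open>k \<le> p\<close> by (rule poly_sum_eqO_zero_imp_coeff_zero)
qed

section \<open>Order conditions of parallel methods\<close>

lemma has_stage_orderD:
  fixes ty :: "'a::euclidean_space itself" and f :: "'a \<Rightarrow> 'a"
  assumes "has_stage_order ty M p W Wh q" "imex_step M p W Wh f g y t0 z Y yout" "i < ninternal M"
  shows "eqO (q + 1) (\<lambda>h. Y h i) (\<lambda>h. y (t0 + absc M i * h))"
  using assms unfolding has_stage_order_def eqO_def by blast

lemma has_orderD:
  fixes ty :: "'a::euclidean_space itself" and f :: "'a \<Rightarrow> 'a"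
  assumes "has_order ty M p W Wh" "imex_step M p W Wh f g y t0 z Y yout" "i < nexternal M"
  shows "eqO (p + 1) (\<lambda>h. yout h i) (\<lambda>h. weight_expansion p W Wh f g y h (t0 + h) i)"
  using assms unfolding has_order_def eqO_def by blast

abbreviation (input) parallel_glm ::
    "nat \<Rightarrow> (nat \<Rightarrow> real) \<Rightarrow> real \<Rightarrow> real mat \<Rightarrow> real mat \<Rightarrow> real mat \<Rightarrow> imex_glm" where
  "parallel_glm s c lam B Bh V \<equiv>
    \<lparr>ninternal = s, nexternal = s, absc = c,
     matA = 0\<^sub>m s s, matAh = lam \<cdot>\<^sub>m 1\<^sub>m s, matB = B, matBh = Bh,
     matU = 1\<^sub>m s, matV = V\<rparr>"

text \<open>The stages decouple: each is an implicit equation of its own, whose only other input is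
  the incoming external stage of the same index. This is why single stages could be analysed
  above.\<close>

lemma internal_stages_parallel:
  "internal_stages (parallel_glm s c lam B Bh V) f g h z Y
    \<longleftrightarrow> (\<forall>i<s. Y i = (h * lam) *\<^sub>R g (Y i) + z i)"
proof -
  have "(\<Sum>j<i. 0\<^sub>m s s $$ (i, j) *\<^sub>R f (Y j)) = 0" if "i < s" for i
    using that by (intro sum.neutral) simp
  moreover have "(\<Sum>j\<le>i. (lam \<cdot>\<^sub>m 1\<^sub>m s) $$ (i, j) *\<^sub>R g (Y j)) = lam *\<^sub>R g (Y i)" if "i < s" for i
  proof -
    have "(\<Sum>j\<le>i. (lam \<cdot>\<^sub>m 1\<^sub>m s) $$ (i, j) *\<^sub>R g (Y j))
        = (\<Sum>j\<in>{i}. (lam \<cdot>\<^sub>m 1\<^sub>m s) $$ (i, j) *\<^sub>R g (Y j))"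
      using that by (intro sum.mono_neutral_right) auto
    then show ?thesis using that by simp
  qed
  moreover have "(\<Sum>j<s. 1\<^sub>m s $$ (i, j) *\<^sub>R z j) = z i" if "i < s" for i
  proof -
    have "(\<Sum>j<s. 1\<^sub>m s $$ (i, j) *\<^sub>R z j) = (\<Sum>j\<in>{i}. 1\<^sub>m s $$ (i, j) *\<^sub>R z j)"
      using that by (intro sum.mono_neutral_right) auto
    then show ?thesis using that by simp
  qed
  ultimately show ?thesis
    by (simp add: internal_stages_def)
qed

lemma external_stages_parallel:
  "external_stages (parallel_glm s c lam B Bh V) f g h z Y yout
    \<longleftrightarrow> (\<forall>i<s. yout i = h *\<^sub>R (\<Sum>j<s. B $$ (i, j) *\<^sub>R f (Y j) + Bh $$ (i, j) *\<^sub>R g (Y j))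
      + (\<Sum>j<s. V $$ (i, j) *\<^sub>R z j))"
  by (simp add: external_stages_def)

lemma imex_step_parallel:
  assumes "imex_step (parallel_glm s c lam B Bh V) p W Wh f g y t0 z Y yout"
  shows "smooth_trajectory f g y t0"
    and "\<And>i. i < s \<Longrightarrow> eqO (Suc p) (\<lambda>h. z h i)
      (smooth_trajectory.wexp f g y t0 p (\<lambda>k. W $$ (i, k)) (\<lambda>k. Wh $$ (i, k)))"
    and "\<And>i. i < s \<Longrightarrow> Bfun (\<lambda>h. Y h i) (at_right 0)"
    and "\<And>i. i < s \<Longrightarrow> \<forall>\<^sub>F h in at_right 0. Y h i = (h * lam) *\<^sub>R g (Y h i) + z h i"
    and "\<And>i. i < s \<Longrightarrow> \<forall>\<^sub>F h in at_right 0. yout h i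
      = h *\<^sub>R (\<Sum>j<s. B $$ (i, j) *\<^sub>R f (Y h j) + Bh $$ (i, j) *\<^sub>R g (Y h j))
        + (\<Sum>j<s. V $$ (i, j) *\<^sub>R z h j)"
proof -
  show tr: "smooth_trajectory f g y t0"
    using assms by (simp add: imex_step_def smooth_trajectory_def)
  interpret smooth_trajectory f g y t0 p by (rule tr)
  show "eqO (Suc p) (\<lambda>h. z h i) (wexp (\<lambda>k. W $$ (i, k)) (\<lambda>k. Wh $$ (i, k)))" if "i < s" for i
    using assms that by (simp add: imex_step_def eqO_def weight_expansion_eq_wexp)
  show "Bfun (\<lambda>h. Y h i) (at_right 0)" if "i < s" for i
    using assms that by (simp add: imex_step_def)
  show "\<forall>\<^sub>F h in at_right 0. Y h i = (h * lam) *\<^sub>R g (Y h i) + z h i" if "i < s" for i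
  proof -
    have "\<forall>\<^sub>F h in at_right 0. \<forall>i<s. Y h i = (h * lam) *\<^sub>R g (Y h i) + z h i"
      using assms by (simp add: imex_step_def internal_stages_parallel)
    then show ?thesis by eventually_elim (use that in blast)
  qed
  show "\<forall>\<^sub>F h in at_right 0. yout h i
      = h *\<^sub>R (\<Sum>j<s. B $$ (i, j) *\<^sub>R f (Y h j) + Bh $$ (i, j) *\<^sub>R g (Y h j))
        + (\<Sum>j<s. V $$ (i, j) *\<^sub>R z h j)" if "i < s" for i
  proof -
    have "\<forall>\<^sub>F h in at_right 0. \<forall>i<s. yout h i
      = h *\<^sub>R (\<Sum>j<s. B $$ (i, j) *\<^sub>R f (Y h j) + Bh $$ (i, j) *\<^sub>R g (Y h j))
        + (\<Sum>j<s. V $$ (i, j) *\<^sub>R z h j)"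
      using assms by (simp add: imex_step_def external_stages_parallel)
    then show ?thesis by eventually_elim (use that in blast)
  qed
qed

lemma parallel_step_output:
  assumes "p > 0" and step: "imex_step (parallel_glm s c lam B Bh V) p W Wh f g y t0 z Y yout"
    and Y: "\<And>j. j < s \<Longrightarrow> eqO (Suc p) (\<lambda>h. Y h j) (\<lambda>h. y (t0 + c j * h))"
    and "i < s"
  shows "eqO (Suc p) (\<lambda>h. yout h i) (smooth_trajectory.wexp f g y t0 p
    (\<lambda>k. (\<Sum>j<s. B $$ (i, j) * tmon_deriv (c j) k) + (\<Sum>j<s. V $$ (i, j) * W $$ (j, k)))
    (\<lambda>k. (\<Sum>j<s. Bh $$ (i, j) * tmon_deriv (c j) k) + (\<Sum>j<s. V $$ (i, j) * Wh $$ (j, k))))"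
proof -
  interpret smooth_trajectory f g y t0 p
    using step by (rule imex_step_parallel)
  show ?thesis
    unfolding eqO_cong_left[OF imex_step_parallel(5)[OF step \<open>i < s\<close>]]
    by (intro output_expansion \<open>p > 0\<close> Y imex_step_parallel(2,3)[OF step])
qed

text \<open>Without an actual step the order definitions would hold vacuously for the test problem.
  The incoming stages are taken to be the exact weight expansion, and the linear stage equation is
  solved by a resolvent.\<close>

lemma linear_test_step:
  fixes e :: "'a::euclidean_space"
  obtains z Y yout where
    "imex_step (parallel_glm s c lam B Bh V) p W Wh (\<lambda>x. (1 - \<beta>) *\<^sub>R x) (\<lambda>x. \<beta> *\<^sub>R x)
      (\<lambda>t. exp t *\<^sub>R e) 0 z Y yout"
proof -
  interpret smooth_trajectory "\<lambda>x. (1 - \<beta>) *\<^sub>R x" "\<lambda>x. \<beta> *\<^sub>R x" "\<lambda>t. exp t *\<^sub>R e" 0 p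
    by (rule smooth_trajectory_exp)
  define z where "z h i = wexp (\<lambda>k. W $$ (i, k)) (\<lambda>k. Wh $$ (i, k)) h" for h i
  define Y where "Y h i = inverse (1 - h * lam * \<beta>) *\<^sub>R z h i" for h i
  define yout where "yout h i = h *\<^sub>R (\<Sum>j<s. B $$ (i, j) *\<^sub>R ((1 - \<beta>) *\<^sub>R Y h j) + Bh $$ (i, j) *\<^sub>R (\<beta> *\<^sub>R Y h j))
      + (\<Sum>j<s. V $$ (i, j) *\<^sub>R z h j)" for h i
  \<comment> \<open>The denominator \<open>1 - h * lam * \<beta>\<close> equals 1 at
    \<open>h = 0\<close>, so the resolvent stays bounded near 0.\<close>
  have "isCont (\<lambda>h. Y h i) 0" for i
    unfolding Y_def z_def wexp_def by (intro continuous_intros) simp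
  then have Bf: "Bfun (\<lambda>h. Y h i) (at_right 0)" for i
    by (rule isCont_imp_Bfun)
  have "((\<lambda>h. h * lam * \<beta>) \<longlongrightarrow> 0 * lam * \<beta>) (at_right 0)"
    by (intro tendsto_intros)
  then have "\<forall>\<^sub>F h in at_right 0. h * lam * \<beta> < 1"
    by (rule order_tendstoD) simp
  then have "\<forall>\<^sub>F h in at_right 0. \<forall>i<s. Y h i = (h * lam) *\<^sub>R (\<beta> *\<^sub>R Y h i) + z h i"
  proof eventually_elim
    case (elim h)
    show ?case
    proof (intro allI impI)
      fix i
      have "(1 - h * lam * \<beta>) *\<^sub>R Y h i = z h i"
        using elim by (simp add: Y_def)
      then show "Y h i = (h * lam) *\<^sub>R (\<beta> *\<^sub>R Y h i) + z h i"
        by (simp add: scaleR_left_diff_distrib diff_eq_eq add.commute)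
    qed
  qed
  then have "imex_step (parallel_glm s c lam B Bh V) p W Wh (\<lambda>x. (1 - \<beta>) *\<^sub>R x) (\<lambda>x. \<beta> *\<^sub>R x)
      (\<lambda>t. exp t *\<^sub>R e) 0 z Y yout"
    using smooth_f smooth_g solution Bf
    unfolding imex_step_def internal_stages_parallel external_stages_parallel
    by (simp add: weight_expansion_eq_wexp z_def yout_def)
  then show ?thesis by (rule that)
qed

lemma linear_test_stage_condition:
  fixes ty :: "'a::euclidean_space itself"
  assumes "p > 0" "has_stage_order ty (parallel_glm s c lam B Bh V) p W Wh p" "i < s" "k \<le> p"
  shows "(if k = 0 then W $$ (i, 0) - 1
    else (1 - \<beta>) * (W $$ (i, k) - tmon (c i) k)
      + \<beta> * (Wh $$ (i, k) - (tmon (c i) k - lam * tmon_deriv (c i) k))) = 0"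
proof -
  \<comment> \<open>The test solution moves along a single line, so the phase space may have any
    dimension.\<close>
  obtain e :: 'a where "e \<noteq> 0"
    using nonzero_Basis[OF SOME_Basis] by (rule that)
  let ?f = "\<lambda>x. (1 - \<beta>) *\<^sub>R x" and ?g = "\<lambda>x. \<beta> *\<^sub>R x" and ?y = "\<lambda>t. exp t *\<^sub>R e"
  obtain z Y yout where
    step: "imex_step (parallel_glm s c lam B Bh V) p W Wh ?f ?g ?y 0 z Y yout"
    by (rule linear_test_step)
  interpret smooth_trajectory ?f ?g ?y 0 p
    by (rule smooth_trajectory_exp)
  have "eqO (Suc p) (\<lambda>h. Y h i) (\<lambda>h. ?y (0 + c i * h))"
    using has_stage_orderD[OF assms(2) step] \<open>i < s\<close> by simp
  from wexp_exp_eqO_zero_imp[OF \<open>e \<noteq> 0\<close> stage_order_necessary[OF \<open>p > 0\<close>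
      imex_step_parallel(4,2,3)[OF step \<open>i < s\<close>] this] \<open>k \<le> p\<close>]
  show ?thesis
    by (cases "k = 0") (simp_all add: tmon_def)
qed

text \<open>The output has two expansions, one from the method and one from its required form at the
  new time. The first is available only for accurate stages, hence stage order is assumed as
  well.\<close>

lemma linear_test_order_condition:
  fixes ty :: "'a::euclidean_space itself" and s i :: nat and B Bh V W Wh :: "real mat" and c :: "nat \<Rightarrow> real"
  assumes "p > 0" "has_stage_order ty (parallel_glm s c lam B Bh V) p W Wh p"
    and "has_order ty (parallel_glm s c lam B Bh V) p W Wh"
    and "W $$ (i, 0) = Wh $$ (i, 0)" "i < s" "k \<le> p"
  defines "R \<equiv> \<lambda>k. (\<Sum>j<s. B $$ (i, j) * tmon_deriv (c j) k) + (\<Sum>j<s. V $$ (i, j) * W $$ (j, k))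
      - shift_coeff (\<lambda>k. W $$ (i, k)) k"
    and "Rh \<equiv> \<lambda>k. (\<Sum>j<s. Bh $$ (i, j) * tmon_deriv (c j) k) + (\<Sum>j<s. V $$ (i, j) * Wh $$ (j, k))
      - shift_coeff (\<lambda>k. Wh $$ (i, k)) k"
  shows "(if k = 0 then R 0 else (1 - \<beta>) * R k + \<beta> * Rh k) = 0"
proof -
  obtain e :: 'a where "e \<noteq> 0"
    using nonzero_Basis[OF SOME_Basis] by (rule that)
  let ?f = "\<lambda>x. (1 - \<beta>) *\<^sub>R x" and ?g = "\<lambda>x. \<beta> *\<^sub>R x" and ?y = "\<lambda>t. exp t *\<^sub>R e"
  obtain z Y yout where
    step: "imex_step (parallel_glm s c lam B Bh V) p W Wh ?f ?g ?y 0 z Y yout"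
    by (rule linear_test_step)
  interpret smooth_trajectory ?f ?g ?y 0 p
    by (rule smooth_trajectory_exp)
  have "eqO (Suc p) (\<lambda>h. Y h j) (\<lambda>h. ?y (0 + c j * h))" if "j < s" for j
    using has_stage_orderD[OF assms(2) step] that by simp
  note out = parallel_step_output[OF \<open>p > 0\<close> step this \<open>i < s\<close>]
  have "eqO (Suc p) (\<lambda>h. yout h i) (\<lambda>h. weight_expansion p W Wh ?f ?g ?y h (0 + h) i)"
    using has_orderD[OF assms(3) step] \<open>i < s\<close> by simp
  from eqO_trans[OF eqO_sym[OF out] eqO_trans[OF this next_weight_expansion[OF assms(4)]]]
  have "eqO (Suc p) (wexp R Rh) (\<lambda>h. 0)"
    unfolding R_def Rh_def wexp_diff[symmetric] by (simp only: eqO_diff_0)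
  from wexp_exp_eqO_zero_imp[OF \<open>e \<noteq> 0\<close> this \<open>k \<le> p\<close>] show ?thesis .
qed

text \<open>The weights disappear from the right-hand side because the stage conditions, with
  \<open>U\<close> the identity, prescribe all their columns up to index \<open>p\<close>.
  Conversely, these prescribed values serve as witnesses.\<close>

theorem order_and_stage_order_parallel_iff:
  fixes ty :: "'a::euclidean_space itself" and lam :: real
  assumes "p > 0"
  defines "\<xi> \<equiv> \<lambda>x k. tmon x k - lam * tmon_deriv x k"
  shows "order_and_stage_order ty (parallel_glm s c lam B Bh V) p p \<longleftrightarrow>
    (\<forall>i<s. \<forall>k\<le>p.
      (\<Sum>j<s. B $$ (i, j) * tmon_deriv (c j) k) + (\<Sum>j<s. V $$ (i, j) * tmon (c j) k)
        = shift_coeff (tmon (c i)) k \<and>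
      (\<Sum>j<s. Bh $$ (i, j) * tmon_deriv (c j) k) + (\<Sum>j<s. V $$ (i, j) * \<xi> (c j) k)
        = shift_coeff (\<xi> (c i)) k)"
    (is "_ \<longleftrightarrow> ?cond")
proof
  assume "order_and_stage_order ty (parallel_glm s c lam B Bh V) p p"
  then obtain W Wh where W0: "\<And>i. i < s \<Longrightarrow> W $$ (i, 0) = Wh $$ (i, 0)"
    and so: "has_stage_order ty (parallel_glm s c lam B Bh V) p W Wh p"
    and o: "has_order ty (parallel_glm s c lam B Bh V) p W Wh"
    unfolding order_and_stage_order_def by auto
  have W: "W $$ (i, k) = tmon (c i) k" if "i < s" "k \<le> p" for i k
    using linear_test_stage_condition[OF \<open>p > 0\<close> so that, of 0]
    by (cases "k = 0") (simp_all add: tmon_def)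
  \<comment> \<open>At \<open>\<beta> = 1\<close> the test isolates \<open>Wh\<close>, except in
    column 0, where it sees the coefficient of \<open>y\<close> and the shared column transfers the
    result.\<close>
  have Wh: "Wh $$ (i, k) = \<xi> (c i) k" if "i < s" "k \<le> p" for i k
    using linear_test_stage_condition[OF \<open>p > 0\<close> so that, of 1] W0[OF that(1)]
    by (cases "k = 0") (simp_all add: tmon_def tmon_deriv_def \<xi>_def)
  show ?cond
  proof (intro allI impI)
    fix i k assume ik: "i < s" "k \<le> p"
    have sW: "shift_coeff (\<lambda>k. W $$ (i, k)) k = shift_coeff (tmon (c i)) k"
      using ik by (intro shift_coeff_cong) (simp add: W)
    have sWh: "shift_coeff (\<lambda>k. Wh $$ (i, k)) k = shift_coeff (\<xi> (c i)) k"
      using ik by (intro shift_coeff_cong) (simp add: Wh)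
    note oc = linear_test_order_condition[OF \<open>p > 0\<close> so o W0[OF ik(1)] ik]
    have R: "(\<Sum>j<s. B $$ (i, j) * tmon_deriv (c j) k) + (\<Sum>j<s. V $$ (i, j) * tmon (c j) k)
        = shift_coeff (tmon (c i)) k"
      using oc[of 0] ik sW by (cases "k = 0") (simp_all add: W)
    have "(\<Sum>j<s. Bh $$ (i, j) * tmon_deriv (c j) k) + (\<Sum>j<s. V $$ (i, j) * \<xi> (c j) k)
        = shift_coeff (\<xi> (c i)) k"
    proof (cases "k = 0")
      \<comment> \<open>For \<open>k = 0\<close> both conditions read alike, since
        \<open>tmon_deriv\<close> vanishes there.\<close>
      case True
      then show ?thesis
        using R by (simp add: tmon_deriv_def \<xi>_def shift_coeff_def)
    next
      case False
      then show ?thesis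
        using oc[of 1] ik by (simp add: Wh sWh)
    qed
    with R show "(\<Sum>j<s. B $$ (i, j) * tmon_deriv (c j) k) + (\<Sum>j<s. V $$ (i, j) * tmon (c j) k)
        = shift_coeff (tmon (c i)) k \<and>
      (\<Sum>j<s. Bh $$ (i, j) * tmon_deriv (c j) k) + (\<Sum>j<s. V $$ (i, j) * \<xi> (c j) k)
        = shift_coeff (\<xi> (c i)) k" ..
  qed
next
  assume cond: ?cond
  define W where "W = mat s (p + 1) (\<lambda>(i, k). tmon (c i) k)"
  define Wh where "Wh = mat s (p + 1) (\<lambda>(i, k). \<xi> (c i) k)"
  have W: "W $$ (i, k) = tmon (c i) k" and Wh: "Wh $$ (i, k) = \<xi> (c i) k"
    if "i < s" "k \<le> p" for i k
    using that by (simp_all add: W_def Wh_def)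
  have stage: "eqO (Suc p) (\<lambda>h. Y h i) (\<lambda>h. y (t0 + c i * h))"
    if step: "imex_step (parallel_glm s c lam B Bh V) p W Wh f g y t0 z Y yout" and "i < s"
    for f g :: "'a \<Rightarrow> 'a" and y t0 z Y yout i
  proof -
    interpret smooth_trajectory f g y t0 p
      using step by (rule imex_step_parallel)
    show ?thesis
      by (rule stage_order_sufficient[OF \<open>p > 0\<close> imex_step_parallel(4,2,3)[OF step \<open>i < s\<close>]])
         (simp_all add: W Wh \<open>i < s\<close> \<xi>_def)
  qed
  have expansion: "eqO (Suc p) (\<lambda>h. yout h i) (\<lambda>h. weight_expansion p W Wh f g y h (t0 + h) i)"
    if step: "imex_step (parallel_glm s c lam B Bh V) p W Wh f g y t0 z Y yout" and "i < s"
    for f g :: "'a \<Rightarrow> 'a" and y t0 z Y yout i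
  proof -
    interpret smooth_trajectory f g y t0 p
      using step by (rule imex_step_parallel)
    have W0: "W $$ (i, 0) = Wh $$ (i, 0)"
      using \<open>i < s\<close> by (simp add: W Wh \<xi>_def tmon_deriv_def)
    let ?R = "\<lambda>k. (\<Sum>j<s. B $$ (i, j) * tmon_deriv (c j) k) + (\<Sum>j<s. V $$ (i, j) * W $$ (j, k))"
    let ?Rh = "\<lambda>k. (\<Sum>j<s. Bh $$ (i, j) * tmon_deriv (c j) k) + (\<Sum>j<s. V $$ (i, j) * Wh $$ (j, k))"
    have "wexp ?R ?Rh h = wexp (shift_coeff (\<lambda>k. W $$ (i, k))) (shift_coeff (\<lambda>k. Wh $$ (i, k))) h" for h
    proof (rule wexp_cong)
      fix k assume k: "k \<le> p"
      have "shift_coeff (\<lambda>k. W $$ (i, k)) k = shift_coeff (tmon (c i)) k"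
        using \<open>i < s\<close> k by (intro shift_coeff_cong) (simp add: W)
      then show "?R k = shift_coeff (\<lambda>k. W $$ (i, k)) k"
        using cond \<open>i < s\<close> k by (simp add: W)
      have "shift_coeff (\<lambda>k. Wh $$ (i, k)) k = shift_coeff (\<xi> (c i)) k"
        using \<open>i < s\<close> k by (intro shift_coeff_cong) (simp add: Wh)
      then show "?Rh k = shift_coeff (\<lambda>k. Wh $$ (i, k)) k"
        using cond \<open>i < s\<close> k by (simp add: Wh)
    qed
    then have "wexp ?R ?Rh = wexp (shift_coeff (\<lambda>k. W $$ (i, k))) (shift_coeff (\<lambda>k. Wh $$ (i, k)))"
      by (rule ext)
    with parallel_step_output[OF \<open>p > 0\<close> step stage[OF step] \<open>i < s\<close>]
    have "eqO (Suc p) (\<lambda>h. yout h i)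
        (wexp (shift_coeff (\<lambda>k. W $$ (i, k))) (shift_coeff (\<lambda>k. Wh $$ (i, k))))"
      by simp
    from eqO_trans[OF this eqO_sym[OF next_weight_expansion[OF W0]]] show ?thesis .
  qed
  have "has_stage_order ty (parallel_glm s c lam B Bh V) p W Wh p"
    using stage unfolding has_stage_order_def eqO_def by simp
  moreover have "has_order ty (parallel_glm s c lam B Bh V) p W Wh"
    using expansion unfolding has_order_def eqO_def by simp
  moreover have "\<forall>i<s. W $$ (i, 0) = Wh $$ (i, 0)"
    by (simp add: W Wh \<xi>_def tmon_deriv_def)
  ultimately show "order_and_stage_order ty (parallel_glm s c lam B Bh V) p p"
    unfolding order_and_stage_order_def
    by (intro exI[of _ W] exI[of _ Wh]) (simp add: W_def Wh_def)
qed

section \<open>Graded families of polynomials\<close>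

text \<open>A family with one member of each degree spans: subtracting a multiple of the top member
  lowers the degree. \<open>Q k \<noteq> 0\<close> is a separate assumption because the zero
  polynomial has degree 0.\<close>

lemma linear_functional_eq_0_of_graded_family:
  fixes F :: "real poly \<Rightarrow> real"
  assumes add: "\<And>\<phi> \<psi>. F (\<phi> + \<psi>) = F \<phi> + F \<psi>"
    and smult: "\<And>a \<phi>. F (Polynomial.smult a \<phi>) = a * F \<phi>"
    and "\<And>k. k \<le> n \<Longrightarrow> degree (Q k) = k" "\<And>k. k \<le> n \<Longrightarrow> Q k \<noteq> 0"
    and "\<And>k. k \<le> n \<Longrightarrow> F (Q k) = 0"
    and "degree \<phi> \<le> n"
  shows "F \<phi> = 0"
  using assms(3-)
proof (induction n arbitrary: \<phi>)
  case 0
  obtain a where a: "\<phi> = [:a:]"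
    using 0 by (metis degree_eq_zeroE le_zero_eq)
  obtain b where b: "Q 0 = [:b:]"
    using 0(1)[of 0] degree_eq_zeroE by auto
  have "b \<noteq> 0" using 0(2)[of 0] b by auto
  then have "\<phi> = Polynomial.smult (a / b) (Q 0)"
    by (simp add: a b)
  then show ?case
    using 0(3)[of 0] by (simp add: smult)
next
  case (Suc n)
  define a where "a = coeff \<phi> (Suc n) / coeff (Q (Suc n)) (Suc n)"
  define \<psi> where "\<psi> = \<phi> + Polynomial.smult (- a) (Q (Suc n))"
  have "coeff (Q (Suc n)) (Suc n) \<noteq> 0"
    using Suc.prems(1,2)[of "Suc n"] by (metis leading_coeff_0_iff order_refl)
  then have "coeff \<psi> (Suc n) = 0"
    by (simp add: \<psi>_def a_def)
  have le: "degree \<psi> \<le> Suc n"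
    unfolding \<psi>_def using Suc.prems(1)[of "Suc n"] Suc.prems(4)
    by (intro degree_add_le) (auto intro: order_trans[OF degree_smult_le])
  have "degree \<psi> \<le> n"
  proof (rule degree_le, intro allI impI)
    fix i assume "n < i"
    show "coeff \<psi> i = 0"
    proof (cases "i = Suc n")
      case False
      then show ?thesis
        using le \<open>n < i\<close> by (intro coeff_eq_0) linarith
    qed (use \<open>coeff \<psi> (Suc n) = 0\<close> in simp)
  qed
  then have "F \<psi> = 0"
    using Suc.prems(1-3) by - (rule Suc.IH, simp_all)
  then show ?case
    using Suc.prems(3)[of "Suc n"] unfolding \<psi>_def add smult by simp
qed

lemma graded_family_independent:
  fixes Q :: "nat \<Rightarrow> real poly"
  assumes "\<And>k. k < n \<Longrightarrow> degree (Q k) = k" "\<And>k. k < n \<Longrightarrow> Q k \<noteq> 0"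
    and "(\<Sum>k<n. Polynomial.smult (x k) (Q k)) = 0" and "k < n"
  shows "x k = 0"
  using assms
proof (induction n arbitrary: k)
  case (Suc n)
  have "coeff (Polynomial.smult (x k) (Q k)) n = 0" if "k < n" for k
    using that Suc.prems(1)[of k] by (simp add: coeff_eq_0)
  then have "coeff (\<Sum>k<n. Polynomial.smult (x k) (Q k)) n = 0"
    unfolding coeff_sum by (intro sum.neutral) simp
  then have "coeff (\<Sum>k<Suc n. Polynomial.smult (x k) (Q k)) n = x n * coeff (Q n) n"
    by simp
  moreover have "coeff (Q n) n \<noteq> 0"
    using Suc.prems(1,2)[of n] by (metis leading_coeff_0_iff lessI)
  ultimately have "x n = 0"
    unfolding Suc.prems(3) by simp
  moreover have "x k = 0" if "k < n"
    using Suc.prems \<open>x n = 0\<close> that by (intro Suc.IH) auto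
  ultimately show ?case
    using Suc.prems(4) less_Suc_eq by blast
qed simp

section \<open>Entries of the coefficient matrices\<close>

lemma mult_mat_entry:
  assumes "A \<in> carrier_mat n m" "B \<in> carrier_mat m r" "i < n" "j < r"
  shows "(A * B) $$ (i, j) = (\<Sum>l<m. A $$ (i, l) * B $$ (l, j))"
proof -
  have "(A * B) $$ (i, j) = row A i \<bullet> col B j"
    using assms by simp
  also have "\<dots> = (\<Sum>l<m. A $$ (i, l) * B $$ (l, j))"
    using assms by (simp add: scalar_prod_def atLeast0LessThan)
  finally show ?thesis .
qed

lemma K_mat_carrier: "K_mat n \<in> carrier_mat n n"
  by (simp add: K_mat_def)

lemma K_mat_power_entry:
  "i < n \<Longrightarrow> j < n \<Longrightarrow> (K_mat n ^\<^sub>m k) $$ (i, j) = (if j = i + k then 1 else 0)"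
proof (induction k arbitrary: j)
  case 0
  then show ?case by (simp add: K_mat_def)
next
  case (Suc k)
  have "(K_mat n ^\<^sub>m Suc k) $$ (i, j) = (\<Sum>l<n. (K_mat n ^\<^sub>m k) $$ (i, l) * K_mat n $$ (l, j))"
    using Suc.prems K_mat_carrier by (simp add: mult_mat_entry[OF pow_carrier_mat[OF K_mat_carrier] K_mat_carrier])
  also have "\<dots> = (\<Sum>l<n. if l = i + k then K_mat n $$ (l, j) else 0)"
    using Suc by (intro sum.cong) auto
  also have "\<dots> = (if j = i + Suc k then 1 else 0)"
    using Suc.prems by (auto simp: K_mat_def)
  finally show ?case .
qed

lemma E_mat_carrier: "E_mat n \<in> carrier_mat n n"
  by (simp add: E_mat_def mat_exp_def K_mat_def)

lemma E_mat_entry: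
  assumes "i < n" "j < n"
  shows "E_mat n $$ (i, j) = (if i \<le> j then 1 / fact (j - i) else 0)"
proof -
  have "E_mat n $$ (i, j) = (\<Sum>k. (K_mat n ^\<^sub>m k) $$ (i, j) / fact k)"
    using assms by (simp add: E_mat_def mat_exp_def K_mat_def)
  \<comment> \<open>The power \<open>k\<close> of the shift meets entry \<open>(i, j)\<close> only
    for \<open>j = i + k\<close>. Below the diagonal truncated subtraction selects
    \<open>k = 0\<close>, where the entry of the identity is 0.\<close>
  also have "\<dots> = (\<Sum>k\<in>{j - i}. (K_mat n ^\<^sub>m k) $$ (i, j) / fact k)"
    using assms by (intro suminf_finite) (auto simp: K_mat_power_entry)
  also have "\<dots> = (if i \<le> j then 1 / fact (j - i) else 0)"
    using assms by (auto simp: K_mat_power_entry)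
  finally show ?thesis .
qed

lemma Eh_mat_carrier: "Eh_mat n \<in> carrier_mat n n"
  by (simp add: Eh_mat_def)

lemma Eh_mat_entry:
  "i < n \<Longrightarrow> j < n \<Longrightarrow>
    Eh_mat n $$ (i, j) = (if i \<le> Suc j then 1 / fact (Suc j - i) else 0)"
  by (simp add: Eh_mat_def)

lemma Vbar_mat_carrier: "Vbar_mat n lam \<in> carrier_mat n n"
  by (simp add: Vbar_mat_def)

lemma mat_inv_inverse:
  assumes "A \<in> carrier_mat n n" "det A \<noteq> 0"
  shows "mat_inv A \<in> carrier_mat n n" "A * mat_inv A = 1\<^sub>m n" "mat_inv A * A = 1\<^sub>m n"
proof -
  obtain B where B: "mat_inverse A = Some B"
    \<comment> \<open>Both facts must refer to the same matrix ring record, so its free extension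
      slot is fixed to the same value.\<close>
    using mat_inverse(1)[OF assms(1), where b = "()"] det_non_zero_imp_unit[OF assms, where b = "()"]
    by (cases "mat_inverse A") auto
  from mat_inverse(2)[OF assms(1) B]
  show "mat_inv A \<in> carrier_mat n n" "A * mat_inv A = 1\<^sub>m n" "mat_inv A * A = 1\<^sub>m n"
    by (simp_all add: mat_inv_def B)
qed

section \<open>Laguerre polynomials and the normalisation of \<open>v_coeff\<close>\<close>

lemma coeff_laguerre_poly:
  "coeff (laguerre_poly n) i = (if i \<le> n then real (n choose i) * (- 1) ^ i / fact i else 0)"
  by (simp add: laguerre_poly_def coeff_sum)

lemma higher_pderiv_laguerre_poly: "(pderiv ^^ n) (laguerre_poly n) = [:(- 1) ^ n:]"
proof (rule poly_eqI)
  show "coeff ((pderiv ^^ n) (laguerre_poly n)) k = coeff [:(- 1) ^ n:] k" for k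
    unfolding coeff_higher_pderiv coeff_laguerre_poly
    by (cases k) (simp_all add: pochhammer_fact[symmetric])
qed

text \<open>The sign in \<open>v_coeff\<close> cancels the one from the top derivative of the
  Laguerre polynomial, and the rational factor is 1. This normalisation gives \<open>V\<close> row
  sums 1.\<close>

lemma v_coeff_1: "v_coeff s lam 1 = 1"
proof -
  have "s + 2 - 1 = s + 1" by simp
  show ?thesis
    unfolding v_coeff_def \<open>s + 2 - 1 = s + 1\<close> higher_pderiv_laguerre_poly
    by (simp add: power_mult_distrib[symmetric])
qed

section \<open>The matrix T\<close>

locale distinct_nodes =
  fixes s :: nat and c :: "nat \<Rightarrow> real"
  assumes s_pos: "s > 0" and inj: "inj_on c {..<s}"
begin

text \<open>Indexed by degree: the columns of \<open>T\<close> come from \<open>Q 0\<close> to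
  \<open>Q (s - 1)\<close>, and \<open>Q s\<close> is \<open>P\<close> itself, which vanishes at the
  nodes.\<close>

definition Q :: "nat \<Rightarrow> real poly" where
  "Q k = (pderiv ^^ (s - k)) (P_poly s c)"

abbreviation "T \<equiv> T_mat s c"

lemma degree_P: "degree (P_poly s c) = s"
proof -
  have "degree (\<Prod>i<s. [:- c i, 1:]) = (\<Sum>i<s. degree [:- c i, 1:])"
    by (rule degree_prod_eq_sum_degree) auto
  then show ?thesis by (simp add: P_poly_def)
qed

lemma degree_Q: "k \<le> s \<Longrightarrow> degree (Q k) = k"
  by (simp add: Q_def degree_higher_pderiv degree_P)

text \<open>The factor \<open>1 / fact s\<close> in \<open>P_poly\<close> exists for this
  normalisation; it makes the first column of \<open>T\<close> constantly 1.\<close>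

lemma Q_0: "Q 0 = 1"
proof -
  have "lead_coeff (\<Prod>i<s. [:- c i, 1:]) = 1"
    by (simp add: lead_coeff_prod)
  then have "coeff (P_poly s c) s = 1 / fact s"
    using degree_P by (simp add: P_poly_def)
  then have "coeff (Q 0) 0 = 1"
    by (simp add: Q_def coeff_higher_pderiv pochhammer_fact[symmetric])
  moreover have "degree (Q 0) = 0"
    by (simp add: degree_Q)
  ultimately show ?thesis
    by (metis degree_eq_zeroE coeff_pCons_0 one_pCons)
qed

lemma pderiv_Q: "k < s \<Longrightarrow> pderiv (Q (Suc k)) = Q k"
proof -
  assume "k < s"
  then have "s - k = Suc (s - Suc k)" by simp
  then show ?thesis by (simp add: Q_def)
qed

lemma Q_nonzero: "k \<le> s \<Longrightarrow> Q k \<noteq> 0"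
  using degree_Q[of k] Q_0 by (cases "k = 0") auto

lemma poly_Q_s: "i < s \<Longrightarrow> poly (Q s) (c i) = 0"
  by (auto simp: Q_def P_poly_def poly_prod)

lemma T_carrier: "T \<in> carrier_mat s s"
  by (simp add: T_mat_def)

lemma T_entry: "i < s \<Longrightarrow> j < s \<Longrightarrow> T $$ (i, j) = poly (Q j) (c i)"
  by (simp add: T_mat_def Q_def)

text \<open>A kernel vector holds the coefficients of a polynomial of degree below s with s distinct
  roots, so the polynomial is zero, and independence of the graded family makes the vector
  zero.\<close>

lemma det_T: "det T \<noteq> 0"
proof
  assume "det T = 0"
  then obtain x where x: "x \<in> carrier_vec s" "x \<noteq> 0\<^sub>v s" and Tx: "T *\<^sub>v x = 0\<^sub>v s"
    using det_0_iff_vec_prod_zero_field[OF T_carrier] by blast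
  define q where "q = (\<Sum>j<s. Polynomial.smult (x $ j) (Q j))"
  have root: "poly q (c i) = 0" if "i < s" for i
  proof -
    have "poly q (c i) = (\<Sum>j<s. T $$ (i, j) * x $ j)"
      using that by (simp add: q_def poly_sum T_entry mult.commute)
    also have "\<dots> = (T *\<^sub>v x) $ i"
      using that x(1) T_carrier by (simp add: scalar_prod_def atLeast0LessThan)
    finally show ?thesis
      using that by (simp add: Tx)
  qed
  have "q = 0"
  proof (rule ccontr)
    assume "q \<noteq> 0"
    have "degree q \<le> s - 1"
      unfolding q_def
      by (intro degree_sum_le) (auto intro!: order_trans[OF degree_smult_le] simp: degree_Q)
    have "s = card (c ` {..<s})"
      using inj by (simp add: card_image)
    also have "\<dots> \<le> card {z. poly q z = 0}"
      using root \<open>q \<noteq> 0\<close> by (intro card_mono poly_roots_finite) auto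
    also have "\<dots> \<le> degree q"
      using \<open>q \<noteq> 0\<close> by (rule card_poly_roots_bound)
    finally show False
      using \<open>degree q \<le> s - 1\<close> s_pos by simp
  qed
  have "x $ j = 0" if "j < s" for j
    by (rule graded_family_independent[of s Q "\<lambda>j. x $ j"])
       (use \<open>q = 0\<close> that in \<open>simp_all add: q_def degree_Q Q_nonzero\<close>)
  then show False
    using x by auto
qed

lemmas T_inverse = mat_inv_inverse[OF T_carrier det_T]

lemma similar_eq_iff:
  assumes "A \<in> carrier_mat s s" "X \<in> carrier_mat s s"
  shows "A = T * X * mat_inv T \<longleftrightarrow> A * T = T * X"
proof
  assume "A = T * X * mat_inv T"
  then show "A * T = T * X"
    using assms T_inverse T_carrier by (simp add: assoc_mult_mat[of _ s s _ s _ s])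
next
  assume AT: "A * T = T * X"
  have "A = A * (T * mat_inv T)"
    using assms T_inverse by simp
  also have "\<dots> = (A * T) * mat_inv T"
    using assms T_inverse T_carrier by (simp add: assoc_mult_mat[of _ s s _ s _ s])
  finally show "A = T * X * mat_inv T"
    by (simp add: AT)
qed

end

section \<open>Unit shift of polynomials\<close>

lemma shift_coeff_diff:
  "shift_coeff (\<lambda>k. a k - x * b k) k = shift_coeff a k - x * shift_coeff b k"
  by (simp add: shift_coeff_def diff_divide_distrib sum_subtractf sum_distrib_left)

lemma poly_tmon: "poly (monom (1 / fact k) k) x = tmon x k"
  by (simp add: poly_monom tmon_def)

lemma pderiv_tmon: "pderiv (monom (1 / fact k) k :: real poly) = (if k = 0 then 0 else monom (1 / fact (k - 1)) (k - 1))"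
  by (cases k) (auto simp: pderiv_monom field_simps simp del: of_nat_Suc)

lemma poly_pderiv_tmon: "poly (pderiv (monom (1 / fact k) k)) x = tmon_deriv x k"
  by (simp add: pderiv_tmon tmon_deriv_def poly_tmon)

text \<open>For a polynomial of degree at most \<open>n\<close> this is the value of \<open>\<phi>\<close> at \<open>x + 1\<close>.\<close>

definition Taylor_shift :: "nat \<Rightarrow> real \<Rightarrow> real poly \<Rightarrow> real" where
  "Taylor_shift n x \<phi> = (\<Sum>m\<le>n. poly ((pderiv ^^ m) \<phi>) x / fact m)"

lemma Taylor_shift_add: "Taylor_shift n x (\<phi> + \<psi>) = Taylor_shift n x \<phi> + Taylor_shift n x \<psi>"
  by (simp add: Taylor_shift_def higher_pderiv_add add_divide_distrib sum.distrib)

lemma Taylor_shift_smult: "Taylor_shift n x (Polynomial.smult a \<phi>) = a * Taylor_shift n x \<phi>"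
  by (simp add: Taylor_shift_def higher_pderiv_smult sum_distrib_left)

lemma higher_pderiv_Appell:
  fixes R :: "nat \<Rightarrow> real poly"
  assumes "pderiv (R 0) = 0" "\<And>k. k < n \<Longrightarrow> pderiv (R (Suc k)) = R k"
  shows "k \<le> n \<Longrightarrow> (pderiv ^^ m) (R k) = (if m \<le> k then R (k - m) else 0)"
proof (induction m)
  case (Suc m)
  show ?case
  proof (cases "m < k")
    case True
    then have "(pderiv ^^ Suc m) (R k) = pderiv (R (Suc (k - Suc m)))"
      using Suc by (simp add: Suc_diff_Suc)
    also have "\<dots> = R (k - Suc m)"
      using True Suc.prems by (intro assms) auto
    finally show ?thesis using True by simp
  next
    case False
    then show ?thesis
      using Suc assms(1) by (cases "m = k") simp_all
  qed
qed simp

text \<open>Scaled monomials and the family \<open>Q\<close> are both Appell sequences. One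
  computation thus yields \<open>shift_coeff\<close> for the former and the Toeplitz coefficients of
  \<open>E_mat\<close> and \<open>Eh_mat\<close> for the latter.\<close>

lemma Taylor_shift_Appell:
  fixes R :: "nat \<Rightarrow> real poly"
  assumes "pderiv (R 0) = 0" "\<And>k. k < n \<Longrightarrow> pderiv (R (Suc k)) = R k" and "k \<le> n"
  shows "Taylor_shift n x (R k) = (\<Sum>l\<le>k. poly (R l) x / fact (k - l))"
proof -
  have "Taylor_shift n x (R k) = (\<Sum>m\<le>n. if m \<le> k then poly (R (k - m)) x / fact m else 0)"
    unfolding Taylor_shift_def
    by (intro sum.cong) (simp_all add: higher_pderiv_Appell[of R n, OF assms])
  also have "\<dots> = (\<Sum>m\<le>k. poly (R (k - m)) x / fact m)"
    using \<open>k \<le> n\<close> by (intro sum.mono_neutral_cong_right) auto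
  also have "\<dots> = (\<Sum>l\<le>k. poly (R l) x / fact (k - l))"
    by (rule sum.reindex_bij_witness[of _ "\<lambda>l. k - l" "\<lambda>l. k - l"]) auto
  finally show ?thesis .
qed

lemma Taylor_shift_tmon:
  "k \<le> n \<Longrightarrow> Taylor_shift n x (monom (1 / fact k) k) = shift_coeff (tmon x) k"
  using Taylor_shift_Appell[of "\<lambda>k. monom (1 / fact k) k" n k x]
  by (simp add: pderiv_tmon poly_tmon shift_coeff_def del: fact_Suc)

lemma Taylor_shift_pderiv_tmon:
  assumes "k \<le> n"
  shows "Taylor_shift n x (pderiv (monom (1 / fact k) k)) = shift_coeff (tmon_deriv x) k"
proof (cases k)
  case 0
  then show ?thesis
    by (simp add: pderiv_tmon Taylor_shift_def shift_coeff_def tmon_deriv_def)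
next
  case (Suc m)
  have "shift_coeff (tmon_deriv x) (Suc m) = shift_coeff (tmon x) m"
    by (simp add: shift_coeff_def tmon_deriv_def sum.atMost_Suc_shift del: sum.atMost_Suc)
  then show ?thesis
    using Suc assms by (simp add: pderiv_tmon Taylor_shift_tmon del: fact_Suc)
qed

section \<open>Matrices with equal rows\<close>

text \<open>Such a matrix is the outer product of the all-ones vector with \<open>u\<close>, which
  bounds the rank by 1. A nonzero column bounds it from below.\<close>

lemma rank_1_rows_equal:
  fixes V :: "real mat"
  assumes V: "V \<in> carrier_mat n n" and "n > 0"
    and u: "\<And>i j. i < n \<Longrightarrow> j < n \<Longrightarrow> V $$ (i, j) = u j"
    and "(\<Sum>j<n. u j) \<noteq> 0"
  shows "vec_space.rank n V = 1"
proof -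
  interpret vec_space "TYPE(real)" n .
  have "rank V \<le> 1"
    by (rule rank_le_1_product_entries[OF V, of "\<lambda>_. 1" u]) (use V u in auto)
  moreover have "rank V \<ge> 1"
  proof -
    obtain j where "j < n" "u j \<noteq> 0"
      using assms(4) by (metis (no_types, lifting) lessThan_iff sum.neutral)
    define v where "v = col V j"
    have v: "v \<in> carrier_vec n" "v $ 0 \<noteq> 0"
      using V \<open>j < n\<close> \<open>u j \<noteq> 0\<close> \<open>n > 0\<close> by (auto simp: v_def u)
    define A where "A = mat_of_cols n [v]"
    have A: "A \<in> carrier_mat n 1" and cA: "cols A = [v]"
      using v by (auto simp: A_def cols_mat_of_cols)
    have "lin_indpt {v}"
    proof
      assume "lin_dep {v}"
      then obtain w where w: "w \<in> carrier_vec 1" "w \<noteq> 0\<^sub>v 1" "A *\<^sub>v w = 0\<^sub>v n"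
        using lin_depE[OF A] cA by auto
      have "(A *\<^sub>v w) $ 0 = v $ 0 * w $ 0"
        using w(1) \<open>n > 0\<close> A by (simp add: A_def scalar_prod_def mat_of_cols_def)
      then have "w $ 0 = 0"
        using w(3) v(2) \<open>n > 0\<close> by simp
      then have "w = 0\<^sub>v 1"
        using w(1) by (intro eq_vecI) auto
      then show False using w(2) by simp
    qed
    moreover have "{v} \<subseteq> set (cols V)"
      using V \<open>j < n\<close> by (auto simp: v_def cols_def)
    ultimately show ?thesis
      using rank_ge_card_indpt[OF V, of "{v}"] by simp
  qed
  ultimately show ?thesis by simp
qed

text \<open>The image consists of constant vectors, so an eigenvector for a nonzero eigenvalue is
  constant, and on constants the matrix acts as multiplication by the sum of
  \<open>u\<close>.\<close>

lemma eigenvalues_rows_equal: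
  fixes V :: "real mat"
  assumes V: "V \<in> carrier_mat n n" and "n > 0"
    and u: "\<And>i j. i < n \<Longrightarrow> j < n \<Longrightarrow> V $$ (i, j) = u j"
    and sum_u: "(\<Sum>j<n. u j) = 1"
  shows "{z. eigenvalue (map_mat complex_of_real V) z \<and> z \<noteq> 0} = {1}"
proof -
  let ?V = "map_mat complex_of_real V"
  have entry: "(?V *\<^sub>v x) $ i = (\<Sum>j<n. complex_of_real (u j) * x $ j)"
    if "x \<in> carrier_vec n" "i < n" for x i
    using that V by (simp add: scalar_prod_def atLeast0LessThan u)
  have "z = 1" if ev: "eigenvalue ?V z" and "z \<noteq> 0" for z
  proof -
    obtain x where x: "x \<in> carrier_vec n" "x \<noteq> 0\<^sub>v n" "?V *\<^sub>v x = z \<cdot>\<^sub>v x"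
      using ev V by (auto simp: eigenvalue_def eigenvector_def)
    define a where "a = (\<Sum>j<n. complex_of_real (u j) * x $ j)"
    have xi: "x $ i = a / z" if "i < n" for i
      using entry[OF x(1) that] x(1) that \<open>z \<noteq> 0\<close> unfolding x(3) a_def[symmetric]
      by (simp add: field_simps)
    have "a = (\<Sum>j<n. complex_of_real (u j)) * (a / z)"
      unfolding a_def[symmetric] sum_distrib_right
      by (subst a_def, intro sum.cong) (simp_all add: xi)
    also have "(\<Sum>j<n. complex_of_real (u j)) = 1"
      using sum_u by (simp flip: of_real_sum)
    finally have "a = a / z" by simp
    moreover have "a \<noteq> 0"
    proof
      assume "a = 0"
      then have "x = 0\<^sub>v n"
        using x(1) xi by (intro eq_vecI) auto
      then show False using x(2) by simp
    qed
    ultimately show ?thesis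
      using \<open>z \<noteq> 0\<close> by (simp add: field_simps)
  qed
  moreover have "eigenvalue ?V 1"
  proof -
    define x :: "complex vec" where "x = vec n (\<lambda>_. 1)"
    have "?V *\<^sub>v x = 1 \<cdot>\<^sub>v x"
    proof (rule eq_vecI)
      fix i assume "i < dim_vec (1 \<cdot>\<^sub>v x)"
      then have i: "i < n" by (simp add: x_def)
      have "(?V *\<^sub>v x) $ i = (\<Sum>j<n. complex_of_real (u j) * x $ j)"
        using i by (intro entry) (simp_all add: x_def)
      also have "\<dots> = (\<Sum>j<n. complex_of_real (u j))"
        by (simp add: x_def)
      also have "\<dots> = 1"
        using sum_u by (simp flip: of_real_sum)
      finally show "(?V *\<^sub>v x) $ i = (1 \<cdot>\<^sub>v x) $ i"
        using i by (simp add: x_def)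
    qed (use V in \<open>simp add: x_def\<close>)
    moreover have "x \<noteq> 0\<^sub>v n"
    proof
      assume "x = 0\<^sub>v n"
      then have "x $ 0 = 0" using \<open>n > 0\<close> by simp
      then show False using \<open>n > 0\<close> by (simp add: x_def)
    qed
    ultimately show ?thesis
      using V unfolding eigenvalue_def eigenvector_def by (intro exI[of _ x]) (simp add: x_def)
  qed
  ultimately show ?thesis by auto
qed

section \<open>The coefficient formulas\<close>

context distinct_nodes
begin

definition V_mat :: "real \<Rightarrow> real mat" where
  "V_mat lam = T * Vbar_mat s lam * mat_inv T"

lemma V_mat_carrier: "V_mat lam \<in> carrier_mat s s"
  unfolding V_mat_def by (intro mult_carrier_mat[of _ s s] T_carrier Vbar_mat_carrier T_inverse(1))

lemma V_mat_mult_T: "V_mat lam * T = T * Vbar_mat s lam"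
  using similar_eq_iff[OF V_mat_carrier Vbar_mat_carrier] V_mat_def by blast

text \<open>Only the first row of \<open>Vbar_mat\<close> is nonzero, and it meets the constant
  first column of \<open>T\<close>. Hence the product has equal rows, and so does
  \<open>V_mat\<close>.\<close>

lemma T_Vbar_entry:
  assumes "i < s" "j < s"
  shows "(T * Vbar_mat s lam) $$ (i, j) = v_coeff s lam (j + 1)"
proof -
  have "(T * Vbar_mat s lam) $$ (i, j) = (\<Sum>l<s. T $$ (i, l) * Vbar_mat s lam $$ (l, j))"
    by (rule mult_mat_entry[OF T_carrier Vbar_mat_carrier assms])
  also have "\<dots> = (\<Sum>l\<in>{0}. T $$ (i, l) * Vbar_mat s lam $$ (l, j))"
    using assms by (intro sum.mono_neutral_right) (auto simp: Vbar_mat_def)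
  also have "\<dots> = v_coeff s lam (j + 1)"
    using assms by (simp add: T_entry Q_0 Vbar_mat_def)
  finally show ?thesis .
qed

lemma V_mat_rows_equal:
  assumes "i < s" "j < s"
  shows "V_mat lam $$ (i, j) = V_mat lam $$ (0, j)"
proof -
  have "V_mat lam $$ (i, j) = (\<Sum>l<s. (T * Vbar_mat s lam) $$ (i, l) * mat_inv T $$ (l, j))"
    if "i < s" for i
    unfolding V_mat_def using T_carrier Vbar_mat_carrier T_inverse(1) that assms(2)
    by (intro mult_mat_entry) auto
  then show ?thesis
    using assms s_pos by (simp add: T_Vbar_entry)
qed

lemma V_mat_mult_Q:
  assumes "i < s" "j < s"
  shows "(\<Sum>l<s. V_mat lam $$ (i, l) * poly (Q j) (c l)) = v_coeff s lam (j + 1)"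
proof -
  have "(\<Sum>l<s. V_mat lam $$ (i, l) * poly (Q j) (c l)) = (V_mat lam * T) $$ (i, j)"
    using assms by (simp add: mult_mat_entry[OF V_mat_carrier T_carrier] T_entry)
  then show ?thesis
    using assms by (simp add: V_mat_mult_T T_Vbar_entry)
qed

lemma V_mat_row_sum: "i < s \<Longrightarrow> (\<Sum>l<s. V_mat lam $$ (i, l)) = 1"
  using V_mat_mult_Q[of i 0 lam] s_pos by (simp add: Q_0 v_coeff_1[simplified])

text \<open>One family for both methods: \<open>\<mu> = 0\<close> belongs to \<open>B\<close> and \<open>\<mu> = lam\<close> to \<open>Bh\<close>.\<close>

definition coeff_mat :: "real \<Rightarrow> real \<Rightarrow> real mat" where
  "coeff_mat lam \<mu> = Eh_mat s - \<mu> \<cdot>\<^sub>m E_mat s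
    + Vbar_mat s lam * (\<mu> \<cdot>\<^sub>m 1\<^sub>m s - transpose_mat (K_mat s))"

lemma coeff_mat_carrier: "coeff_mat lam \<mu> \<in> carrier_mat s s"
  unfolding coeff_mat_def
  by (intro add_carrier_mat mult_carrier_mat[OF Vbar_mat_carrier] minus_carrier_mat)
     (use K_mat_carrier[of s] in simp)

lemma coeff_mat_0: "coeff_mat lam 0 = Eh_mat s - Vbar_mat s lam * transpose_mat (K_mat s)"
proof -
  let ?K = "transpose_mat (K_mat s)"
  have K: "?K \<in> carrier_mat s s"
    using K_mat_carrier[of s] by simp
  have "(0::real) \<cdot>\<^sub>m 1\<^sub>m s - ?K = - ?K"
    using K by (intro eq_matI) auto
  then have "coeff_mat lam 0 = Eh_mat s - 0 \<cdot>\<^sub>m E_mat s + - (Vbar_mat s lam * ?K)"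
    using K Vbar_mat_carrier[of s lam] by (simp add: coeff_mat_def)
  also have "\<dots> = Eh_mat s - Vbar_mat s lam * ?K"
    using Eh_mat_carrier[of s] E_mat_carrier[of s] K Vbar_mat_carrier[of s lam]
    by (intro eq_matI) auto
  finally show ?thesis .
qed

lemma Taylor_shift_Q:
  assumes "k \<le> s"
  shows "Taylor_shift s x (Q k) = (\<Sum>l\<le>k. poly (Q l) x / fact (k - l))"
  by (rule Taylor_shift_Appell) (simp_all add: Q_0 pderiv_Q assms)

text \<open>The product with \<open>Eh_mat\<close> has no term \<open>l = s\<close>, while the shift
  of \<open>Q (Suc j)\<close> has one when \<open>Suc j = s\<close>. At a node this term vanishes
  because \<open>Q s\<close> is \<open>P\<close>; hence the restriction to nodes.\<close>

lemma Taylor_shift_Q_node: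
  assumes "i < s" "j < s"
  shows "Taylor_shift s (c i) (Q j) = (T * E_mat s) $$ (i, j)"
    and "Taylor_shift s (c i) (Q (Suc j)) = (T * Eh_mat s) $$ (i, j)"
proof -
  have "(T * E_mat s) $$ (i, j) = (\<Sum>l<s. poly (Q l) (c i) * (if l \<le> j then 1 / fact (j - l) else 0))"
    using assms by (simp add: mult_mat_entry[OF T_carrier E_mat_carrier] T_entry E_mat_entry)
  also have "\<dots> = (\<Sum>l\<le>j. poly (Q l) (c i) / fact (j - l))"
    using assms by (intro sum.mono_neutral_cong_right) auto
  finally show "Taylor_shift s (c i) (Q j) = (T * E_mat s) $$ (i, j)"
    using assms by (simp add: Taylor_shift_Q)
  have "(T * Eh_mat s) $$ (i, j)
      = (\<Sum>l<s. poly (Q l) (c i) * (if l \<le> Suc j then 1 / fact (Suc j - l) else 0))"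
    using assms by (simp add: mult_mat_entry[OF T_carrier Eh_mat_carrier] T_entry Eh_mat_entry
        del: fact_Suc)
  also have "\<dots> = (\<Sum>l\<le>Suc j. poly (Q l) (c i) / fact (Suc j - l))"
  proof (rule sum.mono_neutral_cong)
    fix l assume "l \<in> {..Suc j} - {..<s}"
    then have "l = s" using assms by auto
    then show "poly (Q l) (c i) / fact (Suc j - l) = 0"
      using poly_Q_s[OF assms(1)] by simp
  qed auto
  finally show "Taylor_shift s (c i) (Q (Suc j)) = (T * Eh_mat s) $$ (i, j)"
    using assms by (simp add: Taylor_shift_Q del: sum.atMost_Suc)
qed

lemma T_coeff_mat_entry:
  assumes ij: "i < s" "j < s"
  shows "(T * coeff_mat lam \<mu>) $$ (i, j)
    = Taylor_shift s (c i) (Q (Suc j)) - \<mu> * Taylor_shift s (c i) (Q j)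
      - (\<Sum>l<s. V_mat lam $$ (i, l) * (poly (Q (Suc j)) (c l) - \<mu> * poly (Q j) (c l)))"
proof -
  let ?Vb = "Vbar_mat s lam" and ?K = "transpose_mat (K_mat s)"
  have carriers: "T \<in> carrier_mat s s" "E_mat s \<in> carrier_mat s s" "Eh_mat s \<in> carrier_mat s s"
    "?Vb \<in> carrier_mat s s" "?K \<in> carrier_mat s s" "T * ?Vb \<in> carrier_mat s s"
    using T_carrier E_mat_carrier Eh_mat_carrier Vbar_mat_carrier K_mat_carrier[of s] by auto
  \<comment> \<open>Multiplying by the transposed shift from the right replaces column
    \<open>j\<close> by column \<open>Suc j\<close> and the last column by zero. The latter matches
    \<open>Q s\<close>, which is zero at the nodes.\<close>
  have VK: "(\<Sum>l<s. V_mat lam $$ (i, l) * poly (Q (Suc j)) (c l)) = (T * ?Vb * ?K) $$ (i, j)"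
  proof -
    have "(T * ?Vb * ?K) $$ (i, j) = (\<Sum>l<s. (T * ?Vb) $$ (i, l) * ?K $$ (l, j))"
      by (rule mult_mat_entry[OF carriers(6,5) ij])
    also have "\<dots> = (\<Sum>l<s. if l = Suc j then (T * ?Vb) $$ (i, l) else 0)"
      using ij by (intro sum.cong) (auto simp: K_mat_def)
    also have "\<dots> = (\<Sum>l<s. V_mat lam $$ (i, l) * poly (Q (Suc j)) (c l))"
    proof (cases "Suc j < s")
      case True
      then show ?thesis
        using ij by (simp add: V_mat_mult_Q T_Vbar_entry)
    next
      case False
      then have "Suc j = s" using ij by simp
      then show ?thesis
        using poly_Q_s by simp
    qed
    finally show ?thesis by simp
  qed
  have V: "(\<Sum>l<s. V_mat lam $$ (i, l) * poly (Q j) (c l)) = (T * ?Vb) $$ (i, j)"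
    using ij by (simp add: V_mat_mult_Q T_Vbar_entry)
  have "T * coeff_mat lam \<mu> = T * (Eh_mat s - \<mu> \<cdot>\<^sub>m E_mat s) + T * (?Vb * (\<mu> \<cdot>\<^sub>m 1\<^sub>m s - ?K))"
    unfolding coeff_mat_def using carriers by (intro mult_add_distrib_mat) auto
  also have "T * (Eh_mat s - \<mu> \<cdot>\<^sub>m E_mat s) = T * Eh_mat s - T * (\<mu> \<cdot>\<^sub>m E_mat s)"
    using carriers by (intro mult_minus_distrib_mat) auto
  also have "T * (\<mu> \<cdot>\<^sub>m E_mat s) = \<mu> \<cdot>\<^sub>m (T * E_mat s)"
    using carriers by (intro mult_smult_distrib)
  also have "T * (?Vb * (\<mu> \<cdot>\<^sub>m 1\<^sub>m s - ?K)) = T * ?Vb * (\<mu> \<cdot>\<^sub>m 1\<^sub>m s - ?K)"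
    using carriers by (intro assoc_mult_mat[symmetric]) auto
  also have "\<dots> = T * ?Vb * (\<mu> \<cdot>\<^sub>m 1\<^sub>m s) - T * ?Vb * ?K"
    using carriers by (intro mult_minus_distrib_mat) auto
  also have "T * ?Vb * (\<mu> \<cdot>\<^sub>m 1\<^sub>m s) = \<mu> \<cdot>\<^sub>m (T * ?Vb)"
    using carriers by (simp add: mult_smult_distrib[OF carriers(6) one_carrier_mat])
  finally have eq: "T * coeff_mat lam \<mu> = T * Eh_mat s - \<mu> \<cdot>\<^sub>m (T * E_mat s)
      + (\<mu> \<cdot>\<^sub>m (T * ?Vb) - T * ?Vb * ?K)" .
  have dims: "dim_row T = s" "dim_col (E_mat s) = s" "dim_col (Eh_mat s) = s" "dim_col ?Vb = s"
    "dim_col ?K = s"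
    using carriers by auto
  have "(T * coeff_mat lam \<mu>) $$ (i, j) = (T * Eh_mat s) $$ (i, j) - \<mu> * (T * E_mat s) $$ (i, j)
      + (\<mu> * (T * ?Vb) $$ (i, j) - (T * ?Vb * ?K) $$ (i, j))"
    unfolding eq using ij dims by (simp del: index_mult_mat(1))
  then show ?thesis
    using ij by (simp add: Taylor_shift_Q_node VK[symmetric] V[symmetric] right_diff_distrib
        sum_subtractf sum_distrib_left mult_ac del: index_mult_mat(1))
qed

text \<open>The order conditions say that a linear functional vanishes on the monomials of degree at most
  \<open>s\<close>.  Testing it instead on the derivatives of \<open>P\<close>, whose values at the nodes are the columns of
  \<open>T\<close>, turns them into the matrix identity \<open>B T = T X\<close>.\<close>

lemma order_conditions_iff:
  assumes B: "B \<in> carrier_mat s s"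
  shows "(\<forall>i<s. \<forall>k\<le>s. (\<Sum>j<s. B $$ (i, j) * tmon_deriv (c j) k)
      + (\<Sum>j<s. V_mat lam $$ (i, j) * (tmon (c j) k - \<mu> * tmon_deriv (c j) k))
      = shift_coeff (\<lambda>k. tmon (c i) k - \<mu> * tmon_deriv (c i) k) k)
    \<longleftrightarrow> B = T * coeff_mat lam \<mu> * mat_inv T"
proof -
  \<comment> \<open>The residual of the order condition in row \<open>i\<close>, as a functional of
    an arbitrary polynomial in place of the scaled monomial.\<close>
  define F where "F i \<phi> = (\<Sum>j<s. B $$ (i, j) * poly (pderiv \<phi>) (c j))
      + (\<Sum>j<s. V_mat lam $$ (i, j) * (poly \<phi> (c j) - \<mu> * poly (pderiv \<phi>) (c j)))
      - (Taylor_shift s (c i) \<phi> - \<mu> * Taylor_shift s (c i) (pderiv \<phi>))" for i \<phi>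
  have add: "F i (\<phi> + \<psi>) = F i \<phi> + F i \<psi>" for i \<phi> \<psi>
    by (simp add: F_def pderiv_add Taylor_shift_add algebra_simps sum.distrib sum_subtractf)
  have smult: "F i (Polynomial.smult a \<phi>) = a * F i \<phi>" for i a \<phi>
    by (simp add: F_def pderiv_smult Taylor_shift_smult algebra_simps sum_distrib_left sum_subtractf)
  have mono: "F i (monom (1 / fact k) k) = 0 \<longleftrightarrow> (\<Sum>j<s. B $$ (i, j) * tmon_deriv (c j) k)
      + (\<Sum>j<s. V_mat lam $$ (i, j) * (tmon (c j) k - \<mu> * tmon_deriv (c j) k))
      = shift_coeff (\<lambda>k. tmon (c i) k - \<mu> * tmon_deriv (c i) k) k" if "k \<le> s" for i k
    unfolding F_def poly_tmon poly_pderiv_tmon Taylor_shift_tmon[OF that]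
      Taylor_shift_pderiv_tmon[OF that] shift_coeff_diff by simp
  \<comment> \<open>On constants the functional does not involve \<open>B\<close>; it is the row sum
    of \<open>V_mat\<close> minus 1.\<close>
  have F0: "F i (Q 0) = 0" if "i < s" for i
    using V_mat_row_sum[OF that, of lam] Taylor_shift_Q[of 0 "c i"]
    by (simp add: F_def Q_0 Taylor_shift_def)
  have FQ: "F i (Q (Suc j)) = 0 \<longleftrightarrow> (B * T) $$ (i, j) = (T * coeff_mat lam \<mu>) $$ (i, j)"
    if ij: "i < s" "j < s" for i j
  proof -
    have "(B * T) $$ (i, j) = (\<Sum>l<s. B $$ (i, l) * poly (Q j) (c l))"
      using ij by (simp add: mult_mat_entry[OF B T_carrier] T_entry)
    then show ?thesis
      unfolding T_coeff_mat_entry[OF ij] F_def pderiv_Q[OF ij(2)] by auto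
  qed
  have "(\<forall>k\<le>s. F i (monom (1 / fact k) k) = 0) \<longleftrightarrow> (\<forall>k\<le>s. F i (Q k) = 0)" for i
  proof
    assume *: "\<forall>k\<le>s. F i (monom (1 / fact k) k) = 0"
    show "\<forall>k\<le>s. F i (Q k) = 0"
    proof (intro allI impI)
      fix k assume "k \<le> s"
      show "F i (Q k) = 0"
        by (rule linear_functional_eq_0_of_graded_family[of "F i" s "\<lambda>k. monom (1 / fact k) k"])
           (use * \<open>k \<le> s\<close> in \<open>simp_all add: add smult degree_monom_eq degree_Q\<close>)
    qed
  next
    assume *: "\<forall>k\<le>s. F i (Q k) = 0"
    show "\<forall>k\<le>s. F i (monom (1 / fact k) k) = 0"
    proof (intro allI impI)
      fix k assume "k \<le> s"
      show "F i (monom (1 / fact k) k) = 0"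
        by (rule linear_functional_eq_0_of_graded_family[of "F i" s Q])
           (use * \<open>k \<le> s\<close> in \<open>simp_all add: add smult degree_monom_eq degree_Q Q_nonzero\<close>)
    qed
  qed
  moreover have "(\<forall>k\<le>s. F i (Q k) = 0) \<longleftrightarrow> (\<forall>j<s. F i (Q (Suc j)) = 0)" if "i < s" for i
  proof (intro iffI allI impI)
    fix k assume "\<forall>j<s. F i (Q (Suc j)) = 0" "k \<le> s"
    then show "F i (Q k) = 0"
      using F0[OF that] by (cases k) auto
  qed auto
  ultimately have "(\<forall>i<s. \<forall>k\<le>s. F i (monom (1 / fact k) k) = 0)
      \<longleftrightarrow> (\<forall>i<s. \<forall>j<s. (B * T) $$ (i, j) = (T * coeff_mat lam \<mu>) $$ (i, j))"
    using FQ by simp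
  also have "\<dots> \<longleftrightarrow> B * T = T * coeff_mat lam \<mu>"
  proof
    assume *: "\<forall>i<s. \<forall>j<s. (B * T) $$ (i, j) = (T * coeff_mat lam \<mu>) $$ (i, j)"
    show "B * T = T * coeff_mat lam \<mu>"
      by (rule eq_matI) (use * B T_carrier coeff_mat_carrier[of lam \<mu>] in \<open>auto simp del: index_mult_mat(1)\<close>)
  qed simp
  also have "\<dots> \<longleftrightarrow> B = T * coeff_mat lam \<mu> * mat_inv T"
    using similar_eq_iff[OF B coeff_mat_carrier] by simp
  finally show ?thesis
    using mono by simp
qed

lemma order_and_stage_order_V_mat_iff:
  assumes "B \<in> carrier_mat s s" "Bh \<in> carrier_mat s s"
  shows "order_and_stage_order TYPE('a::euclidean_space)
      (parallel_glm s c lam B Bh (V_mat lam)) s s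
    \<longleftrightarrow> B = T * coeff_mat lam 0 * mat_inv T \<and> Bh = T * coeff_mat lam lam * mat_inv T"
  unfolding order_and_stage_order_parallel_iff[OF s_pos] order_conditions_iff[OF assms(1), symmetric]
    order_conditions_iff[OF assms(2), symmetric]
  by auto

text \<open>Rank and spectrum come for free from equal rows with sum 1, and the triangular shapes
  from the zero and scalar matrices. Only the sizes of \<open>B\<close> and \<open>Bh\<close> and
  the order conditions remain.\<close>

lemma parallel_imex_dimsim_iff:
  "parallel_imex_dimsim TYPE('a::euclidean_space) (parallel_glm s c lam B Bh (V_mat lam)) lam s s
    \<longleftrightarrow> B \<in> carrier_mat s s \<and> Bh \<in> carrier_mat s s \<and>
      order_and_stage_order TYPE('a) (parallel_glm s c lam B Bh (V_mat lam)) s s"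
proof -
  have "vec_space.rank s (V_mat lam) = 1"
    using V_mat_row_sum[OF s_pos, of lam]
    by (intro rank_1_rows_equal[OF V_mat_carrier s_pos V_mat_rows_equal]) simp_all
  moreover have "{z. eigenvalue (map_mat complex_of_real (V_mat lam)) z \<and> z \<noteq> 0} = {1}"
    using V_mat_row_sum[OF s_pos, of lam]
    by (intro eigenvalues_rows_equal[OF V_mat_carrier s_pos V_mat_rows_equal]) simp_all
  ultimately show ?thesis
    using V_mat_carrier
    by (auto simp: parallel_imex_dimsim_def imex_dimsim_def imex_glm_wf_def)
qed

end

theorem mainTheorem4:
  fixes s :: nat and c :: "nat \<Rightarrow> real" and lam :: real and B Bh :: "real mat"
  defines "T \<equiv> T_mat s c" and "Vb \<equiv> Vbar_mat s lam"
  assumes "s \<ge> 2"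
    and "inj_on c {..<s}"
    and "lam > 0"
    and "poly (pderiv (laguerre_poly (s + 1))) (real (s + 1) / lam) = 0"
  shows "parallel_imex_dimsim TYPE('a::euclidean_space)
      \<lparr>ninternal = s, nexternal = s, absc = c,
       matA = 0\<^sub>m s s, matAh = lam \<cdot>\<^sub>m 1\<^sub>m s, matB = B, matBh = Bh,
       matU = 1\<^sub>m s, matV = T * Vb * mat_inv T\<rparr> lam s s
    \<longleftrightarrow>
      B = T * (Eh_mat s - Vb * transpose_mat (K_mat s)) * mat_inv T \<and>
      Bh = T * (Eh_mat s - lam \<cdot>\<^sub>m E_mat s + Vb * (lam \<cdot>\<^sub>m 1\<^sub>m s - transpose_mat (K_mat s))) * mat_inv T"
proof -
  interpret distinct_nodes s c
    using assms(3,4) by unfold_locales simp_all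
  \<comment> \<open>The equivalence for the order presupposes matrices of the right size. From right
    to left this has to be read off the formulas themselves.\<close>
  have carrier: "T_mat s c * coeff_mat lam \<mu> * mat_inv (T_mat s c) \<in> carrier_mat s s" for \<mu>
    by (intro mult_carrier_mat[of _ s s] T_carrier coeff_mat_carrier T_inverse(1))
  have "parallel_imex_dimsim TYPE('a) (parallel_glm s c lam B Bh (V_mat lam)) lam s s
    \<longleftrightarrow> B = T_mat s c * coeff_mat lam 0 * mat_inv (T_mat s c)
      \<and> Bh = T_mat s c * coeff_mat lam lam * mat_inv (T_mat s c)"
    using parallel_imex_dimsim_iff order_and_stage_order_V_mat_iff carrier by metis
  then show ?thesis
    unfolding coeff_mat_0 unfolding coeff_mat_def V_mat_def T_def Vb_def .
qed

end
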